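(* Let $X_t=(X^1_t,\dots,X^m_t)$, $t=0,1,\dots,T$, be $\mathbb{F}$-adapted processes and let $G\in\mathbb{R}^{m\times m}$ be a deterministic $\mathcal{K}^\dagger$-matrix. Recursively define the $\mathcal{F}_t$-measurable vectors $U_t=(U^1_t,\dots,U^m_t)$ by setting $U_T:=X_T$ and $$U_t:=\operatorname{SOL}\big(X_t,\mathbb{E}_{\mathbb{P}}(U_{t+1}\,|\,\mathcal{F}_t),G\big),\quad t=0,1,\dots,T-1.$$ For $t=0,\dots,T$ define the $\mathbb{F}$-stopping times $\tau^*_t=(\tau^{*1}_t,\dots,\tau^{*m}_t)$ by $$\tau^{*i}_t:=\inf\{u\in\{t,t+1,\dots,T\}:U^i_u=X^i_u\}.$$ Then: (i) the equality $U_t=V_t(\tau^*_t)$ holds for all $t$; (ii) for all $t$, the strategy profile $\tau^*_t$ is an optimal equilibrium of the stochastic affine game $\operatorname{SAG}_t(X,G)$, and $U_t=V^*_t$ is the value of this game.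
   Context: Matrices. A real square matrix is a $\mathcal{P}^\dagger$-matrix if its determinant is non-negative and all its proper principal minors are positive; a $\mathcal{Z}$-matrix if its off-diagonal entries are all non-positive; a $\mathcal{K}^\dagger$-matrix if it is both. For a matrix $G$ and index set $\mathcal{E}$, $G_{k\mathcal{E}}$ is the part of row $k$ with columns in $\mathcal{E}$ and $G_{\mathcal{E}\mathcal{E}}$ is the principal sub-matrix; sub-vectors are denoted $x_{\mathcal{E}}$ or $x^{\mathcal{E}}$. Single-period affine game and SOL. Let $\mathcal{M}=\{1,\dots,m\}$. For $x,p\in\mathbb{R}^m$, the game $\operatorname{AG}(x,p,G)$ has strategy profiles $s\in\{0,1\}^m$, exercising set $\mathcal{E}(s)=\{i:s^i=0\}$ and payoffs $V_i(s)=x_i$ for $i\in\mathcal{E}(s)$, $V_i(s)=p_i+G_{i\mathcal{E}(s)}(G_{\mathcal{E}(s)\mathcal{E}(s)})^{-1}(x_{\mathcal{E}(s)}-p_{\mathcal{E}(s)})$ for $i\notin\mathcal{E}(s)$ (so $V(s)=p$ if $\mathcal{E}(s)=\emptyset$). A Nash equilibrium is a profile from which no single player can increase her own payoff by changing only her own strategy. When $G$ is a $\mathcal{K}^\dagger$-matrix, $\operatorname{AG}(x,p,G)$ has a Nash equilibrium and all Nash equilibria have the same payoff vector; $\operatorname{SOL}(x,p,G)$ denotes this vector. It is applied $\omega$-wise to random vectors. Multi-period game. $(\Omega,\mathcal{F},\mathbb{P})$ is a probability space with filtration $\mathbb{F}=\{\mathcal{F}_t:t=0,1,\dots,T\}$;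 the random vectors $X_t$ are integrable so that all conditional expectations are well defined, and (in)equalities between random variables are understood almost surely. Write $[t,T]=\{t,t+1,\dots,T\}$. For each $t=0,\dots,T$ the stochastic affine game $\operatorname{SAG}_t(X,G)$ is defined recursively, backward in $t$. Strategies of player $k$: the space $\mathcal{S}^k_t$ of $\mathbb{F}$-stopping times with values in $[t,T]$. A strategy profile is $s_t=(s^1_t,\dots,s^m_t)\in\mathcal{S}_t=\prod_k\mathcal{S}^k_t$; put $\widehat s_t=s^1_t\wedge\dots\wedge s^m_t$ and $\mathcal{E}(s_t)=\{i\in\mathcal{M}:s^i_t=\widehat s_t\}$ (a random set). The game stops at $\widehat s_t$; at $T$ everyone must exercise. The outcome is the vector $V_t(s_t)=(V^1_t(s_t),\dots,V^m_t(s_t))$, $$V^k_t(s_t)=\mathbb{E}_{\mathbb{P}}\big(X^k_{\widehat s_t}\mathbf{1}_{\{k\in\mathcal{E}(s_t)\}}+\widehat X^k_{\widehat s_t}\mathbf{1}_{\{k\notin\mathcal{E}(s_t)\}}\,\big|\,\mathcal{F}_t\big),$$ where, on $\{\widehat s_t<T\}$, $$\widehat X^k_{\widehat s_t}=V^{*k}_{\widehat s_t+1}+G_{k\,\mathcal{E}(s_t)}\big(G_{\mathcal{E}(s_t)\mathcal{E}(s_t)}\big)^{-1}\big(X^{\mathcal{E}(s_t)}_{\widehat s_t}-V^{*\mathcal{E}(s_t)}_{\widehat s_t+1}\big),$$ and $V^*_u=(V^{*1}_u,\dots,V^{*m}_u)$ is the value of $\operatorname{SAG}_u(X,G)$ for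 $u=t+1,\dots,T$ (on $\{\widehat s_t=T\}$ all players exercise, so $\widehat X_T$ is irrelevant). It is part of the assertion of the theorem that these values exist, so that the games are well defined. Write $s_t=(s^k_t,s^{-k}_t)$. A profile $\sigma_t\in\mathcal{S}_t$ is an optimal equilibrium of $\operatorname{SAG}_t(X,G)$ if for every $k\in\mathcal{M}$ $$V^k_t(\sigma^k_t,s^{-k}_t)\geq V^k_t(\sigma^k_t,\sigma^{-k}_t)\geq V^k_t(s^k_t,\sigma^{-k}_t)\quad\text{for all } s^k_t\in\mathcal{S}^k_t,\ s^{-k}_t\in\mathcal{S}^{-k}_t.$$ The value of $\operatorname{SAG}_t(X,G)$ is the random vector $V^*_t$ with $V^{*k}_t=\operatorname{ess\,sup}_{s^k_t}\operatorname{ess\,inf}_{s^{-k}_t}V^k_t(s^k_t,s^{-k}_t)=\operatorname{ess\,inf}_{s^{-k}_t}\operatorname{ess\,sup}_{s^k_t}V^k_t(s^k_t,s^{-k}_t)$ for each $k$, provided the second equality holds. *)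

theory Defs
  imports "HOL-Probability.Probability"
begin

text \<open>
  The set of players is the finite type \<open>'n\<close>, so that \<open>m = CARD('n)\<close>. Index sets
  are subsets of \<open>'n\<close>; the principal sub-matrix \<open>A\<^bsub>EE\<^esub>\<close> is never formed as an object of its
  own, only its determinant and its inverse are.
\<close>

subsection \<open>Matrix classes\<close>

text \<open>
  The Leibniz formula of the library determinant, with the index type replaced by the index
  set \<open>E\<close>.
\<close>

definition principal_minor :: "real^'n^'n \<Rightarrow> 'n::finite set \<Rightarrow> real" where
  "principal_minor A E = (\<Sum>p | p permutes E. of_int (sign p) * (\<Prod>i\<in>E. A $ i $ p i))"

lemma principal_minor_UNIV: "principal_minor A UNIV = det A"
  by (simp add: principal_minor_def det_def)

definition P_dagger :: "real^'n^'n::finite \<Rightarrow> bool" where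
  "P_dagger A \<longleftrightarrow> det A \<ge> 0 \<and> (\<forall>E. E \<noteq> {} \<and> E \<noteq> UNIV \<longrightarrow> principal_minor A E > 0)"

definition Z_matrix :: "real^'n^'n::finite \<Rightarrow> bool" where
  "Z_matrix A \<longleftrightarrow> (\<forall>i j. i \<noteq> j \<longrightarrow> A $ i $ j \<le> 0)"

definition K_dagger :: "real^'n^'n::finite \<Rightarrow> bool" where
  "K_dagger A \<longleftrightarrow> P_dagger A \<and> Z_matrix A"

text \<open>
  The inverse of \<open>A\<^bsub>EE\<^esub>\<close>, in the style of \<^const>\<open>matrix_inv\<close>. Only the entries with both
  indices in \<open>E\<close> are meaningful.
\<close>

definition principal_inverse :: "real^'n^'n \<Rightarrow> 'n::finite set \<Rightarrow> real^'n^'n" where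
  "principal_inverse A E = (SOME B. \<forall>i\<in>E. \<forall>j\<in>E.
     (\<Sum>l\<in>E. A $ i $ l * B $ l $ j) = (if i = j then 1 else 0) \<and>
     (\<Sum>l\<in>E. B $ i $ l * A $ l $ j) = (if i = j then 1 else 0))"

subsection \<open>The single-period affine game\<close>

text \<open>The payoff \<open>p\<^sub>i + G\<^bsub>iE\<^esub> (G\<^bsub>EE\<^esub>)\<^sup>-\<^sup>1 (x\<^sub>E - p\<^sub>E)\<close> of a player \<open>i \<notin> E\<close>.\<close>

definition passive_payoff ::
  "real^'n^'n \<Rightarrow> 'n::finite set \<Rightarrow> real^'n \<Rightarrow> real^'n \<Rightarrow> 'n \<Rightarrow> real" where
  "passive_payoff G E x p i =
     p $ i + (\<Sum>j\<in>E. \<Sum>l\<in>E. G $ i $ j * principal_inverse G E $ j $ l * (x $ l - p $ l))"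

definition AG_profiles :: "('n::finite \<Rightarrow> nat) set" where
  "AG_profiles = {s. \<forall>i. s i \<in> {0, 1}}"

definition AG_payoff ::
  "real^'n \<Rightarrow> real^'n \<Rightarrow> real^'n^'n \<Rightarrow> ('n::finite \<Rightarrow> nat) \<Rightarrow> real^'n" where
  "AG_payoff x p G s =
     (\<chi> i. if i \<in> {j. s j = 0} then x $ i else passive_payoff G {j. s j = 0} x p i)"

definition AG_nash ::
  "real^'n \<Rightarrow> real^'n \<Rightarrow> real^'n^'n \<Rightarrow> ('n::finite \<Rightarrow> nat) \<Rightarrow> bool" where
  "AG_nash x p G s \<longleftrightarrow> s \<in> AG_profiles \<and>
     (\<forall>i. \<forall>a\<in>{0, 1}. AG_payoff x p G (s(i := a)) $ i \<le> AG_payoff x p G s $ i)"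

definition SOL :: "real^'n \<Rightarrow> real^'n \<Rightarrow> real^'n^'n::finite \<Rightarrow> real^'n" where
  "SOL x p G = (THE v. \<exists>s. AG_nash x p G s \<and> v = AG_payoff x p G s)"

subsection \<open>Conditional expectation and essential bounds\<close>

definition vec_cond_exp ::
  "'a measure \<Rightarrow> 'a measure \<Rightarrow> ('a \<Rightarrow> real^'n) \<Rightarrow> 'a \<Rightarrow> real^'n::finite" where
  "vec_cond_exp M H Y = (\<lambda>\<omega>. \<chi> i. real_cond_exp M H (\<lambda>\<omega>'. Y \<omega>' $ i) \<omega>)"

text \<open>
  Essential supremum and infimum of a family \<open>(Z i)\<close>, \<open>i \<in> I\<close>, of random variables (as opposed
  to \<^const>\<open>esssup\<close>, which concerns a single one). They are determined up to null sets, hence the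
  choice of a version below.
\<close>

definition is_family_esssup ::
  "'a measure \<Rightarrow> 'i set \<Rightarrow> ('i \<Rightarrow> 'a \<Rightarrow> ereal) \<Rightarrow> ('a \<Rightarrow> ereal) \<Rightarrow> bool" where
  "is_family_esssup M I Z Y \<longleftrightarrow> Y \<in> borel_measurable M \<and>
     (\<forall>i\<in>I. AE \<omega> in M. Z i \<omega> \<le> Y \<omega>) \<and>
     (\<forall>Y'\<in>borel_measurable M. (\<forall>i\<in>I. AE \<omega> in M. Z i \<omega> \<le> Y' \<omega>) \<longrightarrow> (AE \<omega> in M. Y \<omega> \<le> Y' \<omega>))"

definition is_family_essinf ::
  "'a measure \<Rightarrow> 'i set \<Rightarrow> ('i \<Rightarrow> 'a \<Rightarrow> ereal) \<Rightarrow> ('a \<Rightarrow> ereal) \<Rightarrow> bool" where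
  "is_family_essinf M I Z Y \<longleftrightarrow> Y \<in> borel_measurable M \<and>
     (\<forall>i\<in>I. AE \<omega> in M. Y \<omega> \<le> Z i \<omega>) \<and>
     (\<forall>Y'\<in>borel_measurable M. (\<forall>i\<in>I. AE \<omega> in M. Y' \<omega> \<le> Z i \<omega>) \<longrightarrow> (AE \<omega> in M. Y' \<omega> \<le> Y \<omega>))"

definition family_esssup ::
  "'a measure \<Rightarrow> 'i set \<Rightarrow> ('i \<Rightarrow> 'a \<Rightarrow> ereal) \<Rightarrow> 'a \<Rightarrow> ereal" where
  "family_esssup M I Z = (SOME Y. is_family_esssup M I Z Y)"

definition family_essinf ::
  "'a measure \<Rightarrow> 'i set \<Rightarrow> ('i \<Rightarrow> 'a \<Rightarrow> ereal) \<Rightarrow> 'a \<Rightarrow> ereal" where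
  "family_essinf M I Z = (SOME Y. is_family_essinf M I Z Y)"

subsection \<open>The stochastic affine games\<close>

definition stopping_times ::
  "'a measure \<Rightarrow> (nat \<Rightarrow> 'a measure) \<Rightarrow> nat \<Rightarrow> nat \<Rightarrow> ('a \<Rightarrow> nat) set" where
  "stopping_times M F T t = {\<sigma>. stopping_time F \<sigma> \<and> (\<forall>\<omega>\<in>space M. \<sigma> \<omega> \<in> {t..T})}"

definition SAG_profiles ::
  "'a measure \<Rightarrow> (nat \<Rightarrow> 'a measure) \<Rightarrow> nat \<Rightarrow> nat \<Rightarrow> ('n::finite \<Rightarrow> 'a \<Rightarrow> nat) set" where
  "SAG_profiles M F T t = {s. \<forall>i. s i \<in> stopping_times M F T t}"

definition game_end :: "('n::finite \<Rightarrow> 'a \<Rightarrow> nat) \<Rightarrow> 'a \<Rightarrow> nat" where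
  "game_end s \<omega> = Min (range (\<lambda>i. s i \<omega>))"

definition exercisers :: "('n::finite \<Rightarrow> 'a \<Rightarrow> nat) \<Rightarrow> 'a \<Rightarrow> 'n set" where
  "exercisers s \<omega> = {i. s i \<omega> = game_end s \<omega>}"

text \<open>
  The outcome of \<open>SAG\<^sub>t\<close> for player \<open>k\<close>, when \<open>V u\<close> is the value of \<open>SAG\<^sub>u\<close> for \<open>t < u \<le> T\<close>.
  No other \<open>V u\<close> enters: if \<open>game_end s \<omega> = T\<close>, then all players are exercisers.
\<close>

definition SAG_outcome ::
  "'a measure \<Rightarrow> (nat \<Rightarrow> 'a measure) \<Rightarrow> (nat \<Rightarrow> 'a \<Rightarrow> real^'n) \<Rightarrow> real^'n^'n \<Rightarrow>
   (nat \<Rightarrow> 'a \<Rightarrow> real^'n) \<Rightarrow> nat \<Rightarrow> ('n::finite \<Rightarrow> 'a \<Rightarrow> nat) \<Rightarrow> 'n \<Rightarrow> 'a \<Rightarrow> real" where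
  "SAG_outcome M F X G V t s k = real_cond_exp M (F t) (\<lambda>\<omega>.
     if k \<in> exercisers s \<omega> then X (game_end s \<omega>) \<omega> $ k
     else passive_payoff G (exercisers s \<omega>) (X (game_end s \<omega>) \<omega>) (V (game_end s \<omega> + 1) \<omega>) k)"

text \<open>
  In the next two definitions the pair \<open>(a, s\<^bsup>-k\<^esup>)\<close> is written \<open>s(k := a)\<close>, with \<open>s\<close> ranging over
  full profiles whose \<open>k\<close>-th component is immaterial.
\<close>

definition optimal_equilibrium ::
  "'a measure \<Rightarrow> (nat \<Rightarrow> 'a measure) \<Rightarrow> nat \<Rightarrow> (nat \<Rightarrow> 'a \<Rightarrow> real^'n) \<Rightarrow> real^'n^'n \<Rightarrow>
   (nat \<Rightarrow> 'a \<Rightarrow> real^'n) \<Rightarrow> nat \<Rightarrow> ('n::finite \<Rightarrow> 'a \<Rightarrow> nat) \<Rightarrow> bool" where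
  "optimal_equilibrium M F T X G V t \<sigma> \<longleftrightarrow> \<sigma> \<in> SAG_profiles M F T t \<and>
     (\<forall>k.
       (\<forall>s\<in>SAG_profiles M F T t. AE \<omega> in M.
          SAG_outcome M F X G V t (s(k := \<sigma> k)) k \<omega> \<ge> SAG_outcome M F X G V t \<sigma> k \<omega>) \<and>
       (\<forall>a\<in>stopping_times M F T t. AE \<omega> in M.
          SAG_outcome M F X G V t \<sigma> k \<omega> \<ge> SAG_outcome M F X G V t (\<sigma>(k := a)) k \<omega>))"

definition SAG_value ::
  "'a measure \<Rightarrow> (nat \<Rightarrow> 'a measure) \<Rightarrow> nat \<Rightarrow> (nat \<Rightarrow> 'a \<Rightarrow> real^'n) \<Rightarrow> real^'n^'n \<Rightarrow>
   (nat \<Rightarrow> 'a \<Rightarrow> real^'n) \<Rightarrow> nat \<Rightarrow> ('a \<Rightarrow> real^'n::finite) \<Rightarrow> bool" where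
  "SAG_value M F T X G V t v \<longleftrightarrow> v \<in> borel_measurable M \<and>
     (\<forall>k.
       (AE \<omega> in M. ereal (v \<omega> $ k) =
          family_esssup M (stopping_times M F T t) (\<lambda>a.
            family_essinf M (SAG_profiles M F T t) (\<lambda>s \<omega>'.
              ereal (SAG_outcome M F X G V t (s(k := a)) k \<omega>'))) \<omega>) \<and>
       (AE \<omega> in M. ereal (v \<omega> $ k) =
          family_essinf M (SAG_profiles M F T t) (\<lambda>s.
            family_esssup M (stopping_times M F T t) (\<lambda>a \<omega>'.
              ereal (SAG_outcome M F X G V t (s(k := a)) k \<omega>'))) \<omega>))"

text \<open>
  Backward recursion for the values: the condition at \<open>t\<close> determines \<open>V t\<close> up to a null set in
  terms of the \<open>V u\<close> with \<open>t < u \<le> T\<close>.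
\<close>

definition value_process ::
  "'a measure \<Rightarrow> (nat \<Rightarrow> 'a measure) \<Rightarrow> nat \<Rightarrow> (nat \<Rightarrow> 'a \<Rightarrow> real^'n) \<Rightarrow> real^'n^'n \<Rightarrow>
   (nat \<Rightarrow> 'a \<Rightarrow> real^'n::finite) \<Rightarrow> bool" where
  "value_process M F T X G V \<longleftrightarrow> (\<forall>t\<le>T. SAG_value M F T X G V t (V t))"

subsection \<open>The candidate value and the candidate equilibrium\<close>

text \<open>
  The terminal condition is required everywhere, and not only almost surely, so that the
  infimum in \<open>first_contact\<close> is never taken over the empty set.
\<close>

definition SOL_process ::
  "'a measure \<Rightarrow> (nat \<Rightarrow> 'a measure) \<Rightarrow> nat \<Rightarrow> (nat \<Rightarrow> 'a \<Rightarrow> real^'n) \<Rightarrow> real^'n^'n \<Rightarrow>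
   (nat \<Rightarrow> 'a \<Rightarrow> real^'n::finite) \<Rightarrow> bool" where
  "SOL_process M F T X G U \<longleftrightarrow>
     (\<forall>t\<le>T. U t \<in> borel_measurable (F t)) \<and>
     (\<forall>\<omega>\<in>space M. U T \<omega> = X T \<omega>) \<and>
     (\<forall>t<T. AE \<omega> in M. U t \<omega> = SOL (X t \<omega>) (vec_cond_exp M (F t) (U (t + 1)) \<omega>) G)"

definition first_contact ::
  "nat \<Rightarrow> (nat \<Rightarrow> 'a \<Rightarrow> real^'n) \<Rightarrow> (nat \<Rightarrow> 'a \<Rightarrow> real^'n) \<Rightarrow> nat \<Rightarrow> 'n::finite \<Rightarrow> 'a \<Rightarrow> nat" where
  "first_contact T X U t i \<omega> = Inf {u \<in> {t..T}. U u \<omega> $ i = X u \<omega> $ i}"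

end

theory Submission
  imports Defs
begin

text \<open>
  In the single-period game, the equilibrium payoff \<open>v = SOL x p G\<close> satisfies \<open>v \<ge> x\<close> and, for
  each player \<open>k\<close>: if \<open>v\<^sub>k > x\<^sub>k\<close>, then \<open>k\<close> gets at least \<open>v\<^sub>k\<close> by waiting, whichever set \<open>H\<close> of
  other players exercises; and if exactly the other players with \<open>v\<^sub>j = x\<^sub>j\<close> exercise, then \<open>k\<close> gets
  at most \<open>v\<^sub>k\<close> by waiting. Both follow by comparing solutions \<open>y\<close> of \<open>(p + G y)\<^sub>E = x\<^sub>E\<close>
  for different sets \<open>E\<close>, since principal sub-matrices \<open>G\<^bsub>EE\<^esub>\<close> with \<open>E\<close> proper have nonnegative
  inverses; they also imply uniqueness of the equilibrium payoff.

  In the multi-period game, the reward minus \<open>U\<^sub>t\<close> is a sum of one-step increments. The conditional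
  expectation of the increment at time \<open>u\<close> given \<open>F\<^sub>u\<close> replaces \<open>U\<^bsub>u+1\<^esub>\<close> by its conditional
  expectation, because payoffs are affine in the continuation values and the set of exercising
  players is \<open>F\<^sub>u\<close>-measurable. The two single-period properties give this conditional increment of
  player \<open>k\<close> a sign, \<open>\<ge> 0\<close> if \<open>k\<close> stops at first contact, \<open>\<le> 0\<close> if all others do. So the first
  contact profile is a saddle point for each player, and backward induction identifies the
  value process with \<open>U\<close>.
\<close>

subsection \<open>Matrices with positive principal minors\<close>

text \<open>Raising one diagonal entry of a K-dagger matrix makes all principal minors positive, even if \<open>det G = 0\<close>.\<close>

definition bump :: "real^'n^'n \<Rightarrow> 'n::finite \<Rightarrow> real \<Rightarrow> real^'n^'n" where
  "bump A k c = (\<chi> i j. A $ i $ j + (if i = k \<and> j = k then c else 0))"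

lemma bump_mult: "(bump A k c *v z) $ i = (A *v z) $ i + (if i = k then c * z $ k else 0)"
proof -
  have "(bump A k c *v z) $ i = (\<Sum>j\<in>UNIV. A $ i $ j * z $ j + (if j = k then (if i = k then c * z $ k else 0) else 0))"
    unfolding matrix_vector_mult_def bump_def vec_lambda_beta
    by (rule sum.cong) (simp_all add: distrib_right)
  also have "\<dots> = (\<Sum>j\<in>UNIV. A $ i $ j * z $ j) + (if i = k then c * z $ k else 0)"
    by (simp only: sum.distrib sum.delta finite UNIV_I if_True)
  finally show ?thesis by (simp only: matrix_vector_mult_def vec_lambda_beta)
qed

lemma permutes_fixing_iff:
  assumes "k \<in> E"
  shows "p permutes E \<and> p k = k \<longleftrightarrow> p permutes (E - {k})"
proof
  assume "p permutes E \<and> p k = k"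
  then have a: "p permutes E" "p k = k" by blast+
  show "p permutes (E - {k})"
    by (rule permutes_superset[OF a(1)]) (use a in simp)
next
  assume p: "p permutes (E - {k})"
  have "p k = k" by (rule permutes_not_in[OF p]) simp
  moreover have "p permutes E" by (rule permutes_subset[OF p]) simp
  ultimately show "p permutes E \<and> p k = k" by blast
qed

text \<open>The Leibniz sum is affine in the diagonal entry at \<open>k\<close>: only permutations
  fixing \<open>k\<close> meet it, and these are the permutations of \<open>E - {k}\<close>.\<close>

lemma principal_minor_bump:
  "principal_minor (bump A k c) E =
     principal_minor A E + (if k \<in> E then c * principal_minor A (E - {k}) else 0)"
proof (cases "k \<in> E")
  case False
  then show ?thesis
    unfolding principal_minor_def bump_def by (auto intro!: sum.cong prod.cong)
next
  case True
  have fin: "finite {p. p permutes E}" by (simp add: finite_permutations)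
  have split: "(\<Prod>i\<in>E. f i) = f k * (\<Prod>i\<in>E-{k}. f i)" for f :: "'a \<Rightarrow> real"
    using True by (simp add: prod.remove)
  have "principal_minor (bump A k c) E =
    (\<Sum>p | p permutes E. of_int (sign p) * (\<Prod>i\<in>E. A $ i $ p i) +
       (if p k = k then c * (of_int (sign p) * (\<Prod>i\<in>E-{k}. A $ i $ p i)) else 0))"
    unfolding principal_minor_def
  proof (rule sum.cong[OF refl])
    fix p
    have "(\<Prod>i\<in>E-{k}. bump A k c $ i $ p i) = (\<Prod>i\<in>E-{k}. A $ i $ p i)"
      unfolding bump_def by (auto intro!: prod.cong)
    then show "of_int (sign p) * (\<Prod>i\<in>E. bump A k c $ i $ p i) = of_int (sign p) * (\<Prod>i\<in>E. A $ i $ p i) +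
       (if p k = k then c * (of_int (sign p) * (\<Prod>i\<in>E-{k}. A $ i $ p i)) else 0)"
      unfolding split by (simp add: bump_def algebra_simps)
  qed
  also have "\<dots> = principal_minor A E +
     (\<Sum>p\<in>{p. p permutes E}. if p k = k then c * (of_int (sign p) * (\<Prod>i\<in>E-{k}. A $ i $ p i)) else 0)"
    by (simp add: sum.distrib principal_minor_def)
  also have "(\<Sum>p\<in>{p. p permutes E}. if p k = k then c * (of_int (sign p) * (\<Prod>i\<in>E-{k}. A $ i $ p i)) else 0)
     = (\<Sum>p | p permutes (E - {k}). c * (of_int (sign p) * (\<Prod>i\<in>E-{k}. A $ i $ p i)))"
    unfolding sum.inter_filter[OF fin, symmetric]
    by (rule sum.cong) (use permutes_fixing_iff[OF True] in auto)
  finally show ?thesis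
    using True by (simp add: principal_minor_def sum_distrib_left)
qed

section \<open>Principal minors as determinants, and inverses of principal sub-matrices\<close>

definition block :: "real^'n^'n \<Rightarrow> 'n::finite set \<Rightarrow> real^'n^'n" where
  "block A E = (\<chi> i j. if i \<in> E \<and> j \<in> E then A $ i $ j else if i = j then 1 else 0)"

text \<open>Padding by the identity gives the sub-matrix full size without a type for
  \<open>E\<close>, so library facts on \<open>det\<close> and invertibility apply. A permutation
  moving an index outside \<open>E\<close> meets a zero entry there and drops out.\<close>

lemma det_block: "det (block A E) = principal_minor A E"
proof -
  have "det (block A E) = (\<Sum>p | p permutes E. of_int (sign p) * (\<Prod>i\<in>UNIV. block A E $ i $ p i))"
    unfolding det_def
  proof (rule sum.mono_neutral_right)
    show "\<forall>p\<in>{p. p permutes UNIV} - {p. p permutes E}. of_int (sign p) * (\<Prod>i\<in>UNIV. block A E $ i $ p i) = 0"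
    proof
      fix p assume "p \<in> {p. p permutes (UNIV::'a set)} - {p. p permutes E}"
      then have "p permutes UNIV" "\<not> p permutes E" by auto
      then obtain i where "i \<notin> E" "p i \<noteq> i"
        using permutes_superset[of p UNIV E] by blast
      then have "block A E $ i $ p i = 0" by (simp add: block_def)
      then have "(\<Prod>i\<in>UNIV. block A E $ i $ p i) = 0" by (intro prod_zero) auto
      then show "of_int (sign p) * (\<Prod>i\<in>UNIV. block A E $ i $ p i) = 0" by simp
    qed
  qed (use permutes_subset[of _ E UNIV] in \<open>auto simp: finite_permutations\<close>)
  also have "\<dots> = principal_minor A E"
    unfolding principal_minor_def
  proof (rule sum.cong[OF refl])
    fix p assume "p \<in> {p. p permutes E}"
    then have p: "p permutes E" by simp
    have "(\<Prod>i\<in>UNIV. block A E $ i $ p i) = (\<Prod>i\<in>E. block A E $ i $ p i)"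
      by (rule prod.mono_neutral_right) (use permutes_not_in[OF p] in \<open>auto simp: block_def\<close>)
    also have "\<dots> = (\<Prod>i\<in>E. A $ i $ p i)"
      by (rule prod.cong) (use permutes_in_image[OF p] in \<open>auto simp: block_def\<close>)
    finally show "of_int (sign p) * (\<Prod>i\<in>UNIV. block A E $ i $ p i) = of_int (sign p) * (\<Prod>i\<in>E. A $ i $ p i)"
      by simp
  qed
  finally show ?thesis .
qed

lemma sum_supported:
  fixes f :: "'n::finite \<Rightarrow> real"
  assumes "\<And>i. i \<notin> E \<Longrightarrow> f i = 0"
  shows "(\<Sum>i\<in>UNIV. f i) = (\<Sum>i\<in>E. f i)"
  by (rule sum.mono_neutral_right) (use assms in auto)

text \<open>A vector supported in \<open>E\<close> uses only the columns in \<open>E\<close>, so the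
  invertible matrix \<open>block A E\<close> acts on it as \<open>A\<close> does in the rows of
  \<open>E\<close> and as the identity in the others.\<close>

lemma principal_kernel_trivial:
  assumes "principal_minor A E \<noteq> 0" and supp: "\<And>i. i \<notin> E \<Longrightarrow> z $ i = 0"
    and zero: "\<And>i. i \<in> E \<Longrightarrow> (A *v z) $ i = 0"
  shows "z = 0"
proof -
  have "(block A E *v z) $ i = 0" for i
  proof (cases "i \<in> E")
    case True
    then have "(block A E *v z) $ i = (A *v z) $ i"
      unfolding matrix_vector_mult_def by (auto intro!: sum.cong simp: block_def supp)
    then show ?thesis using zero True by simp
  next
    case False
    then show ?thesis
      unfolding matrix_vector_mult_def by (auto intro!: sum.neutral simp: block_def supp)
  qed
  then have "block A E *v z = 0" by (simp add: vec_eq_iff)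
  moreover have "invertible (block A E)"
    using assms(1) by (simp add: invertible_det_nz det_block)
  ultimately show ?thesis
    using matrix_left_invertible_ker invertible_def by metis
qed

text \<open>The choice in \<open>principal_inverse\<close> has a witness: the inverse of
  \<open>block A E\<close>, because the rows and columns of \<open>E\<close> in that matrix vanish
  outside \<open>E\<close>.\<close>

lemma principal_inverse_left_right:
  assumes "principal_minor A E \<noteq> 0"
  shows "\<forall>i\<in>E. \<forall>j\<in>E.
     (\<Sum>l\<in>E. A $ i $ l * principal_inverse A E $ l $ j) = (if i = j then 1 else 0) \<and>
     (\<Sum>l\<in>E. principal_inverse A E $ i $ l * A $ l $ j) = (if i = j then 1 else 0)"
proof -
  have "invertible (block A E)"
    using assms by (simp add: invertible_det_nz det_block)
  then obtain B where B: "block A E ** B = mat 1" "B ** block A E = mat 1"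
    unfolding invertible_def by blast
  have "\<forall>i\<in>E. \<forall>j\<in>E.
     (\<Sum>l\<in>E. A $ i $ l * B $ l $ j) = (if i = j then 1 else 0) \<and>
     (\<Sum>l\<in>E. B $ i $ l * A $ l $ j) = (if i = j then 1 else 0)"
  proof (intro ballI conjI)
    fix i j assume i: "i \<in> E" and j: "j \<in> E"
    have "(\<Sum>l\<in>E. A $ i $ l * B $ l $ j) = (\<Sum>l\<in>E. block A E $ i $ l * B $ l $ j)"
      by (rule sum.cong) (use i in \<open>auto simp: block_def\<close>)
    also have "\<dots> = (\<Sum>l\<in>UNIV. block A E $ i $ l * B $ l $ j)"
      by (rule sum_supported[symmetric]) (use i in \<open>auto simp: block_def\<close>)
    also have "\<dots> = (block A E ** B) $ i $ j"
      by (simp add: matrix_matrix_mult_def)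
    finally show "(\<Sum>l\<in>E. A $ i $ l * B $ l $ j) = (if i = j then 1 else 0)"
      by (simp add: B mat_def)
    have "(\<Sum>l\<in>E. B $ i $ l * A $ l $ j) = (\<Sum>l\<in>E. B $ i $ l * block A E $ l $ j)"
      by (rule sum.cong) (use j in \<open>auto simp: block_def\<close>)
    also have "\<dots> = (\<Sum>l\<in>UNIV. B $ i $ l * block A E $ l $ j)"
      by (rule sum_supported[symmetric]) (use j in \<open>auto simp: block_def\<close>)
    also have "\<dots> = (B ** block A E) $ i $ j"
      by (simp add: matrix_matrix_mult_def)
    finally show "(\<Sum>l\<in>E. B $ i $ l * A $ l $ j) = (if i = j then 1 else 0)"
      by (simp add: B mat_def)
  qed
  then show ?thesis unfolding principal_inverse_def by (rule someI)
qed

section \<open>P-matrices (\<open>positive_minors\<close>), nonnegative inverses and signs of Schur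
  complements\<close>

definition positive_minors :: "real^'n^'n \<Rightarrow> bool" where
  "positive_minors A \<longleftrightarrow> (\<forall>E. principal_minor A (E::'n::finite set) > 0)"

lemma principal_minor_empty [simp]: "principal_minor A {} = 1"
proof -
  have "{p. p permutes {}} = {id}" by auto
  then show ?thesis by (simp add: principal_minor_def)
qed

lemma K_dagger_minor_pos: "K_dagger A \<Longrightarrow> E \<noteq> UNIV \<Longrightarrow> principal_minor A E > 0"
  by (cases "E = {}") (auto simp: K_dagger_def P_dagger_def)

lemma K_dagger_minor_nonneg: "K_dagger A \<Longrightarrow> principal_minor A E \<ge> 0"
  using K_dagger_minor_pos[of A E]
  by (cases "E = UNIV") (auto simp: K_dagger_def P_dagger_def principal_minor_UNIV)

lemma positive_minors_bump:
  assumes "positive_minors A" "c \<ge> 0" shows "positive_minors (bump A k c)"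
  unfolding positive_minors_def
proof
  fix E
  have "principal_minor A E > 0" "principal_minor A (E - {k}) > 0"
    using assms(1) by (auto simp: positive_minors_def)
  then show "principal_minor (bump A k c) E > 0"
    using assms(2) by (simp add: principal_minor_bump add_pos_nonneg)
qed

text \<open>Minors avoiding \<open>k\<close> are unchanged and belong to proper sets. A minor
  containing \<open>k\<close> grows by \<open>c\<close> times the positive minor of
  \<open>E - {k}\<close>; this lifts the one minor that could vanish, \<open>det A\<close>.\<close>

lemma K_dagger_bump:
  assumes "K_dagger A" "c > 0" shows "positive_minors (bump A k c)"
  unfolding positive_minors_def
proof
  fix E
  show "principal_minor (bump A k c) E > 0"
  proof (cases "k \<in> E")
    case True
    have "E - {k} \<noteq> UNIV" by blast
    then have "principal_minor A (E - {k}) > 0" by (rule K_dagger_minor_pos[OF assms(1)])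
    moreover have "principal_minor A E \<ge> 0" by (rule K_dagger_minor_nonneg[OF assms(1)])
    ultimately show ?thesis using assms True by (simp add: principal_minor_bump add_nonneg_pos)
  next
    case False
    then have "principal_minor A E > 0" by (intro K_dagger_minor_pos[OF assms(1)]) blast
    then show ?thesis using False by (simp add: principal_minor_bump)
  qed
qed

lemma Z_matrix_bump: "Z_matrix A \<Longrightarrow> Z_matrix (bump A k c)"
  by (auto simp: Z_matrix_def bump_def)

lemma positive_minors_add_diagonal:
  assumes "positive_minors A" "\<And>i. d i \<ge> 0"
  shows "positive_minors (\<chi> i j. A $ i $ j + (if i = j then d i else 0))"
proof -
  have "positive_minors (\<chi> i j. A $ i $ j + (if i = j \<and> i \<in> K then d i else 0))" if "finite K" for K
    using that
  proof (induction K)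
    case empty
    then show ?case using assms by simp
  next
    case (insert k K)
    have "(\<chi> i j. A $ i $ j + (if i = j \<and> i \<in> insert k K then d i else 0)) =
        bump (\<chi> i j. A $ i $ j + (if i = j \<and> i \<in> K then d i else 0)) k (d k)"
      using insert.hyps by (auto simp: bump_def vec_eq_iff)
    then show ?case using positive_minors_bump[OF insert.IH assms(2)] by (simp only:)
  qed
  from this[of UNIV] show ?thesis by simp
qed

text \<open>If \<open>z\<^sub>i (A z)\<^sub>i \<le> 0\<close> for all \<open>i\<close>, then a nonnegative diagonal \<open>D\<close> can be chosen with
  \<open>(A + D) z = 0\<close> on the support of \<open>z\<close>.\<close>

lemma no_sign_reversal:
  assumes A: "positive_minors A" and sign: "\<And>i. z $ i * (A *v z) $ i \<le> 0"
  shows "z = 0"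
proof -
  define d where "d i = (if z $ i = 0 then 0 else - (A *v z) $ i / z $ i)" for i
  define B where "B = (\<chi> i j. A $ i $ j + (if i = j then d i else 0))"
  have "d i \<ge> 0" for i
    using sign[of i] unfolding d_def
    by (auto simp: divide_simps mult_le_0_iff)
  then have "positive_minors B"
    unfolding B_def by (intro positive_minors_add_diagonal A)
  then have "principal_minor B {i. z $ i \<noteq> 0} \<noteq> 0"
    by (simp add: positive_minors_def less_imp_neq[THEN not_sym])
  moreover have "(B *v z) $ i = (A *v z) $ i + d i * z $ i" for i
  proof -
    have "(B *v z) $ i = (\<Sum>j\<in>UNIV. A $ i $ j * z $ j + (if j = i then d i * z $ i else 0))"
      unfolding matrix_vector_mult_def B_def vec_lambda_beta
      by (rule sum.cong) (simp_all add: distrib_right)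
    also have "\<dots> = (\<Sum>j\<in>UNIV. A $ i $ j * z $ j) + d i * z $ i"
      by (simp only: sum.distrib sum.delta finite UNIV_I if_True)
    finally show ?thesis by (simp only: matrix_vector_mult_def vec_lambda_beta)
  qed
  ultimately show ?thesis
    by (intro principal_kernel_trivial[of B "{i. z $ i \<noteq> 0}"]) (auto simp: d_def)
qed

text \<open>The negative part \<open>n\<close> of \<open>z\<close> satisfies the sign condition of
  \<open>no_sign_reversal\<close>: where \<open>z\<close> is negative, which must be in
  \<open>E\<close>, dropping the nonnegative entries of \<open>z\<close> can only raise
  \<open>A *v z\<close>, as their coefficients are off-diagonal.\<close>

lemma inverse_positive:
  assumes A: "positive_minors A" "Z_matrix A"
    and off: "\<And>i. i \<notin> E \<Longrightarrow> z $ i \<ge> 0" and on: "\<And>i. i \<in> E \<Longrightarrow> (A *v z) $ i \<ge> 0"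
  shows "z $ i \<ge> 0"
proof -
  define n where "n = (\<chi> i. if z $ i < 0 then z $ i else 0)"
  have "n $ i * (A *v n) $ i \<le> 0" for i
  proof (cases "z $ i < 0")
    case True
    then have "i \<in> E" using off[of i] by (cases "i \<in> E") auto
    then have "0 \<le> (A *v z) $ i" by (rule on)
    also have "\<dots> \<le> (A *v n) $ i"
      unfolding matrix_vector_mult_def vec_lambda_beta
    proof (rule sum_mono)
      fix j
      have "A $ i $ j * z $ j \<le> 0" if "\<not> z $ j < 0"
      proof (rule mult_nonpos_nonneg)
        have "i \<noteq> j" using True that by blast
        then show "A $ i $ j \<le> 0" using A(2) by (simp add: Z_matrix_def)
      qed (use that in simp)
      then show "A $ i $ j * z $ j \<le> A $ i $ j * n $ j" by (simp add: n_def)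
    qed
    finally show ?thesis using True by (simp add: n_def mult_nonpos_nonneg)
  qed (simp add: n_def)
  then have "n = 0" by (rule no_sign_reversal[OF A(1)])
  then have "n $ i = 0" by simp
  then show ?thesis by (auto simp: n_def split: if_splits)
qed

text \<open>Since \<open>E\<close> misses some \<open>k\<close>, a bump at \<open>k\<close> yields a
  P-matrix without altering any row in \<open>E\<close>.\<close>

lemma K_dagger_inverse_positive:
  assumes A: "K_dagger A" and "E \<noteq> UNIV"
    and off: "\<And>i. i \<notin> E \<Longrightarrow> z $ i \<ge> 0" and on: "\<And>i. i \<in> E \<Longrightarrow> (A *v z) $ i \<ge> 0"
  shows "z $ i \<ge> 0"
proof -
  obtain k where k: "k \<notin> E" using assms(2) by blast
  show ?thesis
  proof (rule inverse_positive[where A = "bump A k 1" and E = E])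
    show "positive_minors (bump A k 1)" using K_dagger_bump[OF A] by simp
    show "Z_matrix (bump A k 1)" using A by (simp add: Z_matrix_bump K_dagger_def)
    show "(bump A k 1 *v z) $ j \<ge> 0" if "j \<in> E" for j
      using on[OF that] that k by (auto simp: bump_mult)
  qed (rule off)
qed

text \<open>Here \<open>(A *v z) $ k\<close> is \<open>z $ k\<close> times the Schur complement of
  the block on \<open>H\<close>, a quotient of a nonnegative minor by a positive one. The proof
  avoids quotients: a negative value would give a bumped matrix with positive minors a kernel
  vector.\<close>

lemma K_dagger_schur_nonneg:
  assumes A: "K_dagger A" and supp: "\<And>i. i \<notin> insert k H \<Longrightarrow> z $ i = 0"
    and zero: "\<And>i. i \<in> H \<Longrightarrow> (A *v z) $ i = 0" and k: "k \<notin> H" "z $ k \<ge> 0"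
  shows "(A *v z) $ k \<ge> 0"
proof (rule ccontr)
  assume neg: "\<not> (A *v z) $ k \<ge> 0"
  have zk: "z $ k > 0"
  proof (rule ccontr)
    assume "\<not> z $ k > 0"
    then have "z $ k = 0" using k by simp
    moreover have "principal_minor A H > 0"
      using k by (intro K_dagger_minor_pos[OF A]) blast
    ultimately have "z = 0"
      using supp zero by (intro principal_kernel_trivial[of A H]) (simp, metis insertE, blast)
    then show False using neg by simp
  qed
  \<comment> \<open>Chosen so that the bump cancels the value of row \<open>k\<close> at
    \<open>z\<close>.\<close>
  define c where "c = - (A *v z) $ k / z $ k"
  have "c > 0" using neg zk by (simp add: c_def divide_neg_pos)
  then have "principal_minor (bump A k c) (insert k H) \<noteq> 0"
    using K_dagger_bump[OF A, of c k] by (simp add: positive_minors_def less_imp_neq[THEN not_sym])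
  then have "z = 0"
  proof (rule principal_kernel_trivial)
    show "(bump A k c *v z) $ i = 0" if "i \<in> insert k H" for i
      using that zero[of i] zk by (cases "i = k") (simp_all add: bump_mult c_def)
  qed (rule supp)
  then show False using zk by simp
qed

lemma matrix_vector_nonpos:
  assumes "Z_matrix A" "\<And>i. z $ i \<ge> 0" "z $ k = 0"
  shows "(A *v z) $ k \<le> 0"
proof -
  have "A $ k $ j * z $ j \<le> 0" for j
    using assms by (cases "j = k") (auto simp: Z_matrix_def intro!: mult_nonpos_nonneg)
  then show ?thesis by (simp add: matrix_vector_mult_def sum_nonpos)
qed

subsection \<open>Equilibria of the single-period game\<close>

text \<open>For an invertible block, the solution \<open>y\<close> of \<open>(G y)_E = d_E\<close>,
  extended by zero. With \<open>d = x - p\<close>, passive payoffs become \<open>p + G y\<close>, so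
  exercise sets are compared by applying \<open>G\<close> to a difference of such vectors.\<close>

definition active_solution :: "real^'n^'n \<Rightarrow> 'n::finite set \<Rightarrow> real^'n \<Rightarrow> real^'n" where
  "active_solution G E d = (\<chi> j. if j \<in> E then \<Sum>l\<in>E. principal_inverse G E $ j $ l * d $ l else 0)"

lemma active_solution_off: "j \<notin> E \<Longrightarrow> active_solution G E d $ j = 0"
  by (simp add: active_solution_def)

lemma passive_payoff_eq:
  "passive_payoff G E x p i = p $ i + (G *v active_solution G E (x - p)) $ i"
proof -
  have "(G *v active_solution G E (x - p)) $ i = (\<Sum>j\<in>E. G $ i $ j * active_solution G E (x - p) $ j)"
    unfolding matrix_vector_mult_def by (auto intro!: sum_supported simp: active_solution_off)
  also have "\<dots> = (\<Sum>j\<in>E. \<Sum>l\<in>E. G $ i $ j * principal_inverse G E $ j $ l * (x $ l - p $ l))"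
    by (auto intro!: sum.cong simp: active_solution_def sum_distrib_left algebra_simps)
  finally show ?thesis by (simp add: passive_payoff_def)
qed

lemma passive_payoff_empty [simp]: "passive_payoff G {} x p i = p $ i"
  by (simp add: passive_payoff_def)

lemma active_solution_on:
  assumes "principal_minor G E \<noteq> 0" "i \<in> E"
  shows "(G *v active_solution G E d) $ i = d $ i"
proof -
  have "(G *v active_solution G E d) $ i = (\<Sum>j\<in>E. G $ i $ j * active_solution G E d $ j)"
    unfolding matrix_vector_mult_def by (auto intro!: sum_supported simp: active_solution_off)
  also have "\<dots> = (\<Sum>j\<in>E. \<Sum>l\<in>E. G $ i $ j * principal_inverse G E $ j $ l * d $ l)"
    by (auto intro!: sum.cong simp: active_solution_def sum_distrib_left algebra_simps)
  also have "\<dots> = (\<Sum>l\<in>E. \<Sum>j\<in>E. G $ i $ j * principal_inverse G E $ j $ l * d $ l)"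
    by (rule sum.swap)
  also have "\<dots> = (\<Sum>l\<in>E. (\<Sum>j\<in>E. G $ i $ j * principal_inverse G E $ j $ l) * d $ l)"
    by (simp add: sum_distrib_right)
  also have "\<dots> = (\<Sum>l\<in>E. if l = i then d $ l else 0)"
    by (rule sum.cong) (use principal_inverse_left_right[OF assms(1)] assms(2) in auto)
  also have "\<dots> = d $ i" using assms(2) by simp
  finally show ?thesis .
qed

text \<open>Proper sub-matrices are invertible even if \<open>det G = 0\<close>, so for proper
  \<open>E\<close> the one formula \<open>p + G y\<close> gives the payoffs of all players,
  exercising or not.\<close>

lemma passive_payoff_on:
  assumes "K_dagger G" "E \<noteq> UNIV" "i \<in> E"
  shows "passive_payoff G E x p i = x $ i"
proof -
  have "principal_minor G E \<noteq> 0" using K_dagger_minor_pos[OF assms(1,2)] by simp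
  then show ?thesis using active_solution_on[of G E i "x - p"] assms by (simp add: passive_payoff_eq)
qed

definition exercise_profile :: "'n::finite set \<Rightarrow> 'n \<Rightarrow> nat" where
  "exercise_profile E i = (if i \<in> E then 0 else 1)"

definition exercise_payoff :: "real^'n^'n \<Rightarrow> 'n::finite set \<Rightarrow> real^'n \<Rightarrow> real^'n \<Rightarrow> 'n \<Rightarrow> real" where
  "exercise_payoff G E x p k = (if k \<in> E then x $ k else passive_payoff G E x p k)"

lemma AG_payoff_nth: "AG_payoff x p G s $ i = exercise_payoff G {j. s j = 0} x p i"
  by (simp add: AG_payoff_def exercise_payoff_def)

lemma exercise_profile_zero [simp]: "{j. exercise_profile E j = 0} = E"
  by (auto simp: exercise_profile_def)

definition nash_set :: "real^'n \<Rightarrow> real^'n \<Rightarrow> real^'n^'n \<Rightarrow> 'n::finite set \<Rightarrow> bool" where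
  "nash_set x p G E \<longleftrightarrow>
     (\<forall>i\<in>E. passive_payoff G (E - {i}) x p i \<le> x $ i) \<and> (\<forall>i. i \<notin> E \<longrightarrow> x $ i \<le> passive_payoff G E x p i)"

lemma AG_nash_iff: "AG_nash x p G s \<longleftrightarrow> s \<in> AG_profiles \<and> nash_set x p G {j. s j = 0}"
proof (cases "s \<in> AG_profiles")
  case True
  define E where "E = {j. s j = 0}"
  have upd: "{j. (s(i := a)) j = 0} = (if a = 0 then insert i E else E - {i})" for i a
    by (auto simp: E_def)
  have "(\<forall>a\<in>{0, 1}. AG_payoff x p G (s(i := a)) $ i \<le> AG_payoff x p G s $ i) \<longleftrightarrow>
     (i \<in> E \<longrightarrow> passive_payoff G (E - {i}) x p i \<le> x $ i) \<and> (i \<notin> E \<longrightarrow> x $ i \<le> passive_payoff G E x p i)" for i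
    unfolding AG_payoff_nth upd E_def[symmetric]
    by (auto simp: exercise_payoff_def insert_absorb)
  then show ?thesis using True unfolding AG_nash_def nash_set_def E_def[symmetric] by auto
qed (simp add: AG_nash_def)

lemma exercise_profile_in: "exercise_profile E \<in> AG_profiles"
  by (simp add: AG_profiles_def exercise_profile_def)

text \<open>For proper \<open>E\<close>, the Nash conditions are equivalent to the linear complementarity problem
  \<open>y \<ge> 0\<close>, \<open>p + G y \<ge> x\<close> for the active solution \<open>y\<close>.\<close>

lemma nash_set_active_nonneg:
  assumes G: "K_dagger G" and E: "E \<noteq> UNIV" and N: "nash_set x p G E"
  shows "active_solution G E (x - p) $ i \<ge> 0"
proof (cases "i \<in> E")
  case True
  \<comment> \<open>The second vector vanishes at \<open>i\<close>, so \<open>?z $ i\<close> is the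
    entry in question. On \<open>E\<close> the image of \<open>?z\<close> is zero except at
    \<open>i\<close>, where the Nash condition gives its sign.\<close>
  let ?z = "active_solution G E (x - p) - active_solution G (E - {i}) (x - p)"
  have Gz: "(G *v ?z) $ j = passive_payoff G E x p j - passive_payoff G (E - {i}) x p j" for j
    by (simp add: passive_payoff_eq matrix_vector_mult_diff_distrib)
  have "E - {i} \<noteq> UNIV" using E by blast
  then have "(G *v ?z) $ j \<ge> 0" if "j \<in> E" for j
    unfolding Gz using that N E True G passive_payoff_on[of G E j x p] passive_payoff_on[of G "E - {i}" j x p]
    by (cases "j = i") (auto simp: nash_set_def)
  then have "?z $ i \<ge> 0"
    by (rule K_dagger_inverse_positive[OF G E, rotated]) (simp_all add: active_solution_off)
  then show ?thesis by (simp add: active_solution_off)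
qed (simp add: active_solution_off)

text \<open>The difference of the two active solutions has zero image on \<open>E - {i}\<close>, so
  the Schur complement carries the sign of its entry at \<open>i\<close> over to its image at
  \<open>i\<close>.\<close>

lemma active_nonneg_deviation:
  assumes G: "K_dagger G" and E: "E \<noteq> UNIV" and N: "\<And>i. active_solution G E (x - p) $ i \<ge> 0" and i: "i \<in> E"
  shows "passive_payoff G (E - {i}) x p i \<le> x $ i"
proof -
  let ?z = "active_solution G E (x - p) - active_solution G (E - {i}) (x - p)"
  have Gz: "(G *v ?z) $ j = passive_payoff G E x p j - passive_payoff G (E - {i}) x p j" for j
    by (simp add: passive_payoff_eq matrix_vector_mult_diff_distrib)
  have E': "E - {i} \<noteq> UNIV" using E by blast
  have "(G *v ?z) $ i \<ge> 0"
  proof (rule K_dagger_schur_nonneg[OF G, where H = "E - {i}"])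
    show "(G *v ?z) $ j = 0" if "j \<in> E - {i}" for j
      using that E' G E unfolding Gz by (simp add: passive_payoff_on)
    show "?z $ i \<ge> 0" using N by (simp add: active_solution_off)
  qed (use i in \<open>auto simp: active_solution_off\<close>)
  then show ?thesis unfolding Gz using E G i by (simp add: passive_payoff_on)
qed

lemma nash_ge_exercise:
  assumes "nash_set x p G E" shows "x $ k \<le> exercise_payoff G E x p k"
  using assms by (auto simp: nash_set_def exercise_payoff_def)

text \<open>The Nash solution dominates the active solution of every \<open>H\<close> avoiding
  \<open>k\<close>: on \<open>H\<close> its payoffs are at least \<open>x\<close>, off
  \<open>H\<close> it is nonnegative. The difference vanishes at \<open>k\<close>, so only
  nonpositive off-diagonal entries of \<open>G\<close> act in row \<open>k\<close>.\<close>

lemma nash_le_passive: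
  assumes G: "K_dagger G" and N: "nash_set x p G E" and k: "x $ k < exercise_payoff G E x p k" "k \<notin> H"
  shows "exercise_payoff G E x p k \<le> passive_payoff G H x p k"
proof -
  have kE: "k \<notin> E" using k(1) by (auto simp: exercise_payoff_def)
  then have E: "E \<noteq> UNIV" by blast
  have H: "H \<noteq> UNIV" using k by blast
  let ?z = "active_solution G E (x - p) - active_solution G H (x - p)"
  have Gz: "(G *v ?z) $ j = passive_payoff G E x p j - passive_payoff G H x p j" for j
    by (simp add: passive_payoff_eq matrix_vector_mult_diff_distrib)
  have pos: "?z $ i \<ge> 0" for i
  proof (rule K_dagger_inverse_positive[OF G H])
    show "(G *v ?z) $ j \<ge> 0" if "j \<in> H" for j
      using that N passive_payoff_on[OF G E, of j x p]
      unfolding Gz by (cases "j \<in> E") (auto simp: passive_payoff_on[OF G H] nash_set_def)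
  qed (use nash_set_active_nonneg[OF G E N] in \<open>simp add: active_solution_off\<close>)
  have "(G *v ?z) $ k \<le> 0"
    by (rule matrix_vector_nonpos[OF _ pos]) (use G kE k in \<open>auto simp: K_dagger_def active_solution_off\<close>)
  then show ?thesis unfolding Gz using kE by (simp add: exercise_payoff_def)
qed

text \<open>Exercising players have payoff \<open>x\<close>, so \<open>E\<close> lies in
  \<open>insert k H\<close> and the difference of active solutions is supported there, with zero
  image on \<open>H\<close>; its entry at \<open>k\<close> is that of the Nash solution. If
  \<open>E = UNIV\<close>, the claim is the Nash condition of \<open>k\<close>.\<close>

lemma nash_ge_passive_contact:
  assumes G: "K_dagger G" and N: "nash_set x p G E"
    and H: "H = {j. j \<noteq> k \<and> exercise_payoff G E x p j = x $ j}"
  shows "passive_payoff G H x p k \<le> exercise_payoff G E x p k"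
proof (cases "E = UNIV")
  case True
  then have "H = E - {k}" by (auto simp: H exercise_payoff_def)
  then show ?thesis using N True by (simp add: nash_set_def exercise_payoff_def)
next
  case E: False
  have HU: "H \<noteq> UNIV" unfolding H by blast
  let ?z = "active_solution G E (x - p) - active_solution G H (x - p)"
  have Gz: "(G *v ?z) $ j = passive_payoff G E x p j - passive_payoff G H x p j" for j
    by (simp add: passive_payoff_eq matrix_vector_mult_diff_distrib)
  have payoff: "exercise_payoff G E x p j = passive_payoff G E x p j" for j
    using passive_payoff_on[OF G E] by (simp add: exercise_payoff_def)
  have "k \<notin> H" by (simp add: H)
  have "(G *v ?z) $ k \<ge> 0"
  proof (rule K_dagger_schur_nonneg[OF G, where H = H])
    show "(G *v ?z) $ j = 0" if "j \<in> H" for j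
      using that payoff unfolding Gz passive_payoff_on[OF G HU that] by (simp add: H)
    show "?z $ k \<ge> 0"
      using nash_set_active_nonneg[OF G E N] \<open>k \<notin> H\<close> by (simp add: active_solution_off)
    show "?z $ i = 0" if "i \<notin> insert k H" for i
    proof -
      have "i \<notin> E" "i \<notin> H" using that by (auto simp: H exercise_payoff_def)
      then show ?thesis by (simp add: active_solution_off)
    qed
  qed fact
  then show ?thesis unfolding Gz payoff by simp
qed

text \<open>Two payoff vectors are compared at a player \<open>k\<close> through the contact set of one of them.\<close>

lemma nash_payoff_le:
  assumes G: "K_dagger G" and N: "nash_set x p G E" "nash_set x p G E'"
  shows "exercise_payoff G E x p k \<le> exercise_payoff G E' x p k"
proof (rule ccontr)
  assume "\<not> ?thesis"
  then have lt: "exercise_payoff G E' x p k < exercise_payoff G E x p k" by simp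
  let ?H = "{j. j \<noteq> k \<and> exercise_payoff G E' x p j = x $ j}"
  have "exercise_payoff G E x p k \<le> passive_payoff G ?H x p k"
    using nash_ge_exercise[OF N(2), of k] lt by (intro nash_le_passive[OF G N(1)]) auto
  also have "\<dots> \<le> exercise_payoff G E' x p k"
    by (rule nash_ge_passive_contact[OF G N(2)]) simp
  finally show False using lt by simp
qed

text \<open>Closes the existence proof when the exercising set grows to everyone, where no active
  solution need exist. If some \<open>j\<close> preferred to leave, the difference \<open>?z\<close>
  would have nonnegative image, hence be nonnegative, hence vanish at \<open>j\<close>; the
  Z-property then contradicts the positive image at \<open>j\<close>.\<close>

lemma nash_set_UNIV:
  assumes G: "K_dagger G" and i: "passive_payoff G (- {i}) x p i < x $ i"
    and N: "\<And>j. active_solution G (- {i}) (x - p) $ j \<ge> 0"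
  shows "nash_set x p G UNIV"
proof -
  have "passive_payoff G (- {j}) x p j \<le> x $ j" for j
  proof (rule ccontr)
    assume "\<not> ?thesis"
    then have j: "x $ j < passive_payoff G (- {j}) x p j" by simp
    then have ne: "j \<noteq> i" using i by auto
    let ?z = "active_solution G (- {j}) (x - p) - active_solution G (- {i}) (x - p)"
    have Gz: "(G *v ?z) $ l = passive_payoff G (- {j}) x p l - passive_payoff G (- {i}) x p l" for l
      by (simp add: passive_payoff_eq matrix_vector_mult_diff_distrib)
    have on: "passive_payoff G (- {a}) x p l = x $ l" if "l \<noteq> a" for a l
      using that G by (intro passive_payoff_on) auto
    have zj: "?z $ j \<le> 0" using N[of j] by (simp add: active_solution_off)
    have Gzj: "(G *v ?z) $ j > 0" using j ne unfolding Gz by (simp add: on)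
    have Gz_nonneg: "(G *v ?z) $ l \<ge> 0" for l
      using j ne i unfolding Gz by (cases "l = i"; cases "l = j") (auto simp: on)
    \<comment> \<open>\<open>G\<close> itself may be singular, so row \<open>j\<close> is bumped;
      this \<open>c\<close> is small enough that the bumped image at \<open>j\<close> equals
      \<open>c\<close>, still positive.\<close>
    define c where "c = (G *v ?z) $ j / (1 - ?z $ j)"
    have c: "c > 0" using Gzj zj by (simp add: c_def)
    have "(G *v ?z) $ j + c * ?z $ j = c"
      using zj by (simp add: c_def field_simps)
    then have bump_nonneg: "(bump G j c *v ?z) $ l \<ge> 0" for l
      using Gz_nonneg[of l] c by (cases "l = j") (simp_all add: bump_mult)
    have pos: "?z $ l \<ge> 0" for l
      by (rule inverse_positive[OF K_dagger_bump[OF G c, of j], of UNIV])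
        (use bump_nonneg G in \<open>auto simp: Z_matrix_bump K_dagger_def\<close>)
    have "(G *v ?z) $ j \<le> 0"
      by (rule matrix_vector_nonpos[OF _ pos]) (use G zj pos[of j] in \<open>auto simp: K_dagger_def\<close>)
    then show False using Gzj by simp
  qed
  then show ?thesis by (simp add: nash_set_def Compl_eq_Diff_UNIV)
qed

text \<open>If \<open>E\<close> is a maximal proper set whose active solution is nonnegative, a player outside \<open>E\<close>
  who prefers to exercise can be added to \<open>E\<close>; by maximality this yields the full set.\<close>

lemma nash_set_exists:
  assumes G: "K_dagger G" shows "\<exists>E. nash_set x p G E"
proof -
  define S where "S = {E. E \<noteq> UNIV \<and> (\<forall>i. active_solution G E (x - p) $ i \<ge> 0)}"
  have "{} \<in> S" by (simp add: S_def active_solution_off)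
  then obtain E where E: "E \<in> S" and max: "\<And>E'. E' \<in> S \<Longrightarrow> E \<subseteq> E' \<Longrightarrow> E' = E"
    using finite_has_maximal[of S] by (metis empty_iff finite)
  have EU: "E \<noteq> UNIV" and N: "\<And>i. active_solution G E (x - p) $ i \<ge> 0"
    using E by (auto simp: S_def)
  show ?thesis
  proof (cases "\<exists>i. i \<notin> E \<and> passive_payoff G E x p i < x $ i")
    case False
    then have "nash_set x p G E"
      using active_nonneg_deviation[OF G EU N] by (auto simp: nash_set_def not_less)
    then show ?thesis ..
  next
    case True
    then obtain i where i: "i \<notin> E" "passive_payoff G E x p i < x $ i" by blast
    show ?thesis
    proof (cases "insert i E = UNIV")
      case True
      then have "E = - {i}" using i by auto
      then show ?thesis using nash_set_UNIV[OF G, of i x p] i N by auto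
    next
      case U: False
      let ?z = "active_solution G (insert i E) (x - p) - active_solution G E (x - p)"
      have Gz: "(G *v ?z) $ j = passive_payoff G (insert i E) x p j - passive_payoff G E x p j" for j
        by (simp add: passive_payoff_eq matrix_vector_mult_diff_distrib)
      \<comment> \<open>Adding \<open>i\<close> leaves the payoffs on \<open>E\<close> at
        \<open>x\<close> and raises that of \<open>i\<close>, so the active solution can only
        increase and the larger set contradicts maximality.\<close>
      have "?z $ j \<ge> 0" for j
      proof (rule K_dagger_inverse_positive[OF G U])
        show "(G *v ?z) $ l \<ge> 0" if "l \<in> insert i E" for l
          using that i passive_payoff_on[OF G EU, of l x p] unfolding Gz passive_payoff_on[OF G U that] by auto
      qed (simp add: active_solution_off)
      then have "active_solution G (insert i E) (x - p) $ j \<ge> 0" for j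
        using N[of j] by (simp add: algebra_simps) (meson order_trans)
      then have "insert i E \<in> S" using U by (simp add: S_def)
      then show ?thesis using max i by blast
    qed
  qed
qed

section \<open>\<open>SOL\<close> as the common payoff of all equilibria\<close>

lemma SOL_nash:
  assumes G: "K_dagger G" and N: "nash_set x p G E"
  shows "SOL x p G $ k = exercise_payoff G E x p k"
proof -
  have "SOL x p G = AG_payoff x p G (exercise_profile E)"
    unfolding SOL_def
  proof (rule the_equality)
    show "\<exists>s. AG_nash x p G s \<and> AG_payoff x p G (exercise_profile E) = AG_payoff x p G s"
      using N by (auto simp: AG_nash_iff exercise_profile_in intro!: exI[of _ "exercise_profile E"])
  next
    \<comment> \<open>Payoffs of two equilibria bound each other, which makes the definite
      description well defined.\<close>
    fix v assume "\<exists>s. AG_nash x p G s \<and> v = AG_payoff x p G s"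
    then show "v = AG_payoff x p G (exercise_profile E)"
      using N nash_payoff_le[OF G] by (auto simp: vec_eq_iff AG_payoff_nth AG_nash_iff intro!: antisym)
  qed
  then show ?thesis by (simp add: AG_payoff_nth)
qed

lemma SOL_ge: "K_dagger G \<Longrightarrow> x $ k \<le> SOL x p G $ k"
  by (metis nash_set_exists SOL_nash nash_ge_exercise)

lemma SOL_le_passive:
  "K_dagger G \<Longrightarrow> x $ k < SOL x p G $ k \<Longrightarrow> k \<notin> H \<Longrightarrow> SOL x p G $ k \<le> passive_payoff G H x p k"
  by (metis nash_set_exists SOL_nash nash_le_passive)

lemma SOL_ge_passive_contact:
  assumes G: "K_dagger G" and H: "H = {j. j \<noteq> k \<and> SOL x p G $ j = x $ j}"
  shows "passive_payoff G H x p k \<le> SOL x p G $ k"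
proof -
  obtain E where E: "nash_set x p G E" using nash_set_exists[OF G] by blast
  show ?thesis
    using nash_ge_passive_contact[OF G E, of H k] H by (simp add: SOL_nash[OF G E])
qed

subsection \<open>Essential bounds of families\<close>

text \<open>Exhaustion: the measures of countable subunions attain their supremum, since countably
  many near-optimal subfamilies combine into a countable one. Adding one more \<open>A i\<close>
  cannot raise the maximum, so the excess is null.\<close>

lemma (in finite_measure) essential_union:
  assumes A: "\<And>i. i \<in> I \<Longrightarrow> A i \<in> sets M"
  shows "\<exists>J. countable J \<and> J \<subseteq> I \<and> (\<forall>i\<in>I. AE \<omega> in M. \<omega> \<in> A i \<longrightarrow> \<omega> \<in> (\<Union>j\<in>J. A j))"
proof -
  define C where "C = {J. countable J \<and> J \<subseteq> I}"
  define g where "g J = emeasure M (\<Union>j\<in>J. A j)" for J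
  have meas: "(\<Union>j\<in>J. A j) \<in> sets M" if "J \<in> C" for J
    using that A by (auto simp: C_def intro!: sets.countable_UN')
  have "{} \<in> C" by (simp add: C_def)
  then have "g ` C \<noteq> {}" by blast
  from ennreal_Sup_countable_SUP[OF this]
  obtain f :: "nat \<Rightarrow> ennreal" where f: "range f \<subseteq> g ` C" "Sup (g ` C) = (SUP n. f n)"
    by blast
  have "\<forall>n. \<exists>J. J \<in> C \<and> f n = g J" using f(1) by (auto simp: subset_iff image_iff)
  then obtain K where K: "\<And>n. K n \<in> C" "\<And>n. f n = g (K n)" by metis
  define J where "J = (\<Union>n. K n)"
  have J: "J \<in> C" using K(1) by (auto simp: C_def J_def)
  have max: "g J' \<le> g J" if "J' \<in> C" for J'
  proof -
    have "g J' \<le> Sup (g ` C)" using that by (intro Sup_upper) blast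
    also have "\<dots> = (SUP n. g (K n))" by (simp add: f(2) K(2))
    also have "\<dots> \<le> g J"
      unfolding g_def by (intro SUP_least emeasure_mono meas J) (auto simp: J_def)
    finally show ?thesis .
  qed
  have "AE \<omega> in M. \<omega> \<in> A i \<longrightarrow> \<omega> \<in> (\<Union>j\<in>J. A j)" if i: "i \<in> I" for i
  proof -
    have iJ: "insert i J \<in> C" using J i by (auto simp: C_def)
    have eq: "(\<Union>j\<in>insert i J. A j) - (\<Union>j\<in>J. A j) = A i - (\<Union>j\<in>J. A j)" by auto
    have lt: "g (insert i J) < top" unfolding g_def by (simp only: less_top[symmetric] emeasure_finite not_False_eq_True)
    have "emeasure M (A i - (\<Union>j\<in>J. A j)) = g (insert i J) - g J"
      unfolding g_def eq[symmetric]
      by (intro emeasure_Diff meas J iJ) auto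
    also have "\<dots> = 0" using max[OF iJ] lt by (simp add: diff_eq_0_iff_ennreal)
    finally have "A i - (\<Union>j\<in>J. A j) \<in> null_sets M"
      using A[OF i] meas[OF J] by auto
    then show ?thesis by (rule AE_I') auto
  qed
  then show ?thesis using J by (auto simp: C_def)
qed

text \<open>The essential infimum is a countable infimum: for each rational \<open>q\<close>, countably many of the
  sets \<open>{Z i < q}\<close> exhaust all of them up to null sets.\<close>

lemma (in finite_measure) is_family_essinf_family_essinf:
  assumes Z [measurable]: "\<And>i. i \<in> I \<Longrightarrow> Z i \<in> borel_measurable M"
  shows "is_family_essinf M I Z (family_essinf M I Z)"
proof -
  define B where "B q i = {\<omega>\<in>space M. Z i \<omega> < ereal (of_rat q)}" for q i
  have "\<forall>q. \<exists>J. countable J \<and> J \<subseteq> I \<and> (\<forall>i\<in>I. AE \<omega> in M. \<omega> \<in> B q i \<longrightarrow> \<omega> \<in> (\<Union>j\<in>J. B q j))"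
    by (intro allI essential_union) (simp add: B_def)
  from choice[OF this] obtain J where J: "\<forall>q. countable (J q) \<and> J q \<subseteq> I \<and>
      (\<forall>i\<in>I. AE \<omega> in M. \<omega> \<in> B q i \<longrightarrow> \<omega> \<in> (\<Union>j\<in>J q. B q j))" ..
  define K where "K = (\<Union>q. J q)"
  have K: "countable K" "K \<subseteq> I" using J by (auto simp: K_def)
  define Y where "Y \<omega> = (INF j\<in>K. Z j \<omega>)" for \<omega>
  have "is_family_essinf M I Z Y"
    unfolding is_family_essinf_def
  proof (intro conjI ballI impI)
    show "Y \<in> borel_measurable M"
      unfolding Y_def using K by (intro borel_measurable_INF) auto
    fix i assume i: "i \<in> I"
    have "AE \<omega> in M. \<forall>q. \<omega> \<in> B q i \<longrightarrow> \<omega> \<in> (\<Union>j\<in>J q. B q j)"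
      unfolding AE_all_countable using J i by simp
    then show "AE \<omega> in M. Y \<omega> \<le> Z i \<omega>"
      using AE_space[of M]
    proof eventually_elim
      case (elim \<omega>)
      show ?case
      proof (rule ccontr)
        assume "\<not> Y \<omega> \<le> Z i \<omega>"
        then obtain r where r: "Z i \<omega> < ereal r" "ereal r < Y \<omega>"
          using ereal_dense2[of "Z i \<omega>" "Y \<omega>"] by (auto simp: not_le)
        \<comment> \<open>\<open>Y \<omega>\<close> may be infinite, so a second real is inserted
          before a rational is placed between the two.\<close>
        then obtain r' where r': "r < r'" "ereal r' < Y \<omega>"
          using ereal_dense2[of "ereal r" "Y \<omega>"] by auto
        then obtain q where q: "r < of_rat q" "of_rat q < r'" using of_rat_dense by blast
        have "Z i \<omega> < ereal (of_rat q)" using r(1) q(1) by (simp add: less_trans)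
        then obtain j where "j \<in> J q" "Z j \<omega> < ereal (of_rat q)" using elim by (auto simp: B_def)
        then have "Y \<omega> < ereal (of_rat q)"
          unfolding Y_def K_def by (intro INF_lower2[THEN le_less_trans]) auto
        also have "\<dots> < ereal r'" using q(2) by simp
        finally show False using r'(2) by simp
      qed
    qed
  next
    fix Y' assume Y': "\<forall>i\<in>I. AE \<omega> in M. Y' \<omega> \<le> Z i \<omega>"
    have "AE \<omega> in M. \<forall>j\<in>K. Y' \<omega> \<le> Z j \<omega>"
      using Y' K by (subst AE_ball_countable) auto
    then show "AE \<omega> in M. Y' \<omega> \<le> Y \<omega>"
      by eventually_elim (auto simp: Y_def intro: INF_greatest)
  qed
  then show ?thesis unfolding family_essinf_def by (rule someI[of "is_family_essinf M I Z"])
qed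

lemma is_family_esssup_uminus:
  assumes "is_family_essinf M I (\<lambda>i \<omega>. - Z i \<omega>) Y"
  shows "is_family_esssup M I Z (\<lambda>\<omega>. - Y \<omega>)"
  unfolding is_family_esssup_def
proof (intro conjI ballI impI)
  show "(\<lambda>\<omega>. - Y \<omega>) \<in> borel_measurable M" using assms by (simp add: is_family_essinf_def)
  show "AE \<omega> in M. Z i \<omega> \<le> - Y \<omega>" if "i \<in> I" for i
  proof -
    have "AE \<omega> in M. Y \<omega> \<le> - Z i \<omega>" using assms that by (simp add: is_family_essinf_def)
    then show ?thesis by eventually_elim (metis ereal_minus_le_minus ereal_uminus_uminus)
  qed
  fix Y' assume Y': "Y' \<in> borel_measurable M" "\<forall>i\<in>I. AE \<omega> in M. Z i \<omega> \<le> Y' \<omega>"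
  then have "(\<lambda>\<omega>. - Y' \<omega>) \<in> borel_measurable M" "\<forall>i\<in>I. AE \<omega> in M. - Y' \<omega> \<le> - Z i \<omega>" by auto
  then have "AE \<omega> in M. - Y' \<omega> \<le> Y \<omega>" using assms by (simp add: is_family_essinf_def)
  then show "AE \<omega> in M. - Y \<omega> \<le> Y' \<omega>" by eventually_elim (metis ereal_minus_le_minus ereal_uminus_uminus)
qed

lemma (in finite_measure) is_family_esssup_family_esssup:
  assumes "\<And>i. i \<in> I \<Longrightarrow> Z i \<in> borel_measurable M"
  shows "is_family_esssup M I Z (family_esssup M I Z)"
proof -
  have "is_family_essinf M I (\<lambda>i \<omega>. - Z i \<omega>) (family_essinf M I (\<lambda>i \<omega>. - Z i \<omega>))"
    using assms by (intro is_family_essinf_family_essinf) simp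
  then show ?thesis
    unfolding family_esssup_def by (rule someI[of "is_family_esssup M I Z", OF is_family_esssup_uminus])
qed

lemma is_family_esssup_AE_eq:
  assumes "is_family_esssup M I Z Y" shows "AE \<omega> in M. Y \<omega> = family_esssup M I Z \<omega>"
proof -
  have "is_family_esssup M I Z (family_esssup M I Z)"
    unfolding family_esssup_def using assms by (rule someI[of "is_family_esssup M I Z"])
  with assms have "AE \<omega> in M. Y \<omega> \<le> family_esssup M I Z \<omega>" "AE \<omega> in M. family_esssup M I Z \<omega> \<le> Y \<omega>"
    by (auto simp: is_family_esssup_def)
  then show ?thesis by eventually_elim auto
qed

lemma is_family_essinf_AE_eq:
  assumes "is_family_essinf M I Z Y" shows "AE \<omega> in M. Y \<omega> = family_essinf M I Z \<omega>"
proof -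
  have "is_family_essinf M I Z (family_essinf M I Z)"
    unfolding family_essinf_def using assms by (rule someI[of "is_family_essinf M I Z"])
  with assms have "AE \<omega> in M. Y \<omega> \<le> family_essinf M I Z \<omega>" "AE \<omega> in M. family_essinf M I Z \<omega> \<le> Y \<omega>"
    by (auto simp: is_family_essinf_def)
  then show ?thesis by eventually_elim auto
qed

text \<open>\<open>a'\<close> secures \<open>v\<close> against every \<open>s\<close>, and
  \<open>s'\<close> holds every \<open>a\<close> down to \<open>v\<close>. Hence the infimum for
  \<open>a'\<close> is at least \<open>v\<close>, and no infimum exceeds \<open>v\<close>, each
  being bounded by its value at \<open>s'\<close>. The other order is dual.\<close>

lemma (in finite_measure) saddle_point_value:
  fixes Z :: "'i \<Rightarrow> 'j \<Rightarrow> 'a \<Rightarrow> real"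
  assumes Z: "\<And>a s. a \<in> A \<Longrightarrow> s \<in> S \<Longrightarrow> Z a s \<in> borel_measurable M"
    and v: "v \<in> borel_measurable M"
    and a': "a' \<in> A" "\<And>s. s \<in> S \<Longrightarrow> AE \<omega> in M. v \<omega> \<le> Z a' s \<omega>"
    and s': "s' \<in> S" "\<And>a. a \<in> A \<Longrightarrow> AE \<omega> in M. Z a s' \<omega> \<le> v \<omega>"
  shows "AE \<omega> in M. ereal (v \<omega>) = family_esssup M A (\<lambda>a. family_essinf M S (\<lambda>s \<omega>. ereal (Z a s \<omega>))) \<omega>"
    and "AE \<omega> in M. ereal (v \<omega>) = family_essinf M S (\<lambda>s. family_esssup M A (\<lambda>a \<omega>. ereal (Z a s \<omega>))) \<omega>"
proof -
  have inf: "is_family_essinf M S (\<lambda>s \<omega>. ereal (Z a s \<omega>)) (family_essinf M S (\<lambda>s \<omega>. ereal (Z a s \<omega>)))"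
    if "a \<in> A" for a
    using Z that by (intro is_family_essinf_family_essinf) simp
  have sup: "is_family_esssup M A (\<lambda>a \<omega>. ereal (Z a s \<omega>)) (family_esssup M A (\<lambda>a \<omega>. ereal (Z a s \<omega>)))"
    if "s \<in> S" for s
    using Z that by (intro is_family_esssup_family_esssup) simp
  have v': "(\<lambda>\<omega>. ereal (v \<omega>)) \<in> borel_measurable M" using v by simp
  show "AE \<omega> in M. ereal (v \<omega>) = family_esssup M A (\<lambda>a. family_essinf M S (\<lambda>s \<omega>. ereal (Z a s \<omega>))) \<omega>"
  proof (rule is_family_esssup_AE_eq)
    have lower: "AE \<omega> in M. ereal (v \<omega>) \<le> family_essinf M S (\<lambda>s \<omega>. ereal (Z a' s \<omega>)) \<omega>"
      using inf[OF a'(1)] v' a'(2) by (simp add: is_family_essinf_def)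
    show "is_family_esssup M A (\<lambda>a. family_essinf M S (\<lambda>s \<omega>. ereal (Z a s \<omega>))) (\<lambda>\<omega>. ereal (v \<omega>))"
      unfolding is_family_esssup_def
    proof (intro conjI ballI impI v')
      fix a assume a: "a \<in> A"
      have "AE \<omega> in M. family_essinf M S (\<lambda>s \<omega>. ereal (Z a s \<omega>)) \<omega> \<le> ereal (Z a s' \<omega>)"
        using inf[OF a] s'(1) by (simp add: is_family_essinf_def)
      then show "AE \<omega> in M. family_essinf M S (\<lambda>s \<omega>. ereal (Z a s \<omega>)) \<omega> \<le> ereal (v \<omega>)"
        using s'(2)[OF a] by eventually_elim (meson ereal_less_eq(3) order_trans)
    next
      fix Y' :: "'a \<Rightarrow> ereal"
      assume "\<forall>a\<in>A. AE \<omega> in M. family_essinf M S (\<lambda>s \<omega>. ereal (Z a s \<omega>)) \<omega> \<le> Y' \<omega>"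
      then have "AE \<omega> in M. family_essinf M S (\<lambda>s \<omega>. ereal (Z a' s \<omega>)) \<omega> \<le> Y' \<omega>" using a' by blast
      then show "AE \<omega> in M. ereal (v \<omega>) \<le> Y' \<omega>"
        using lower by eventually_elim (rule order_trans)
    qed
  qed
  show "AE \<omega> in M. ereal (v \<omega>) = family_essinf M S (\<lambda>s. family_esssup M A (\<lambda>a \<omega>. ereal (Z a s \<omega>))) \<omega>"
  proof (rule is_family_essinf_AE_eq)
    have upper: "AE \<omega> in M. family_esssup M A (\<lambda>a \<omega>. ereal (Z a s' \<omega>)) \<omega> \<le> ereal (v \<omega>)"
      using sup[OF s'(1)] v' s'(2) by (simp add: is_family_esssup_def)
    show "is_family_essinf M S (\<lambda>s. family_esssup M A (\<lambda>a \<omega>. ereal (Z a s \<omega>))) (\<lambda>\<omega>. ereal (v \<omega>))"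
      unfolding is_family_essinf_def
    proof (intro conjI ballI impI v')
      fix s assume s: "s \<in> S"
      have "AE \<omega> in M. ereal (Z a' s \<omega>) \<le> family_esssup M A (\<lambda>a \<omega>. ereal (Z a s \<omega>)) \<omega>"
        using sup[OF s] a'(1) by (simp add: is_family_esssup_def)
      then show "AE \<omega> in M. ereal (v \<omega>) \<le> family_esssup M A (\<lambda>a \<omega>. ereal (Z a s \<omega>)) \<omega>"
        using a'(2)[OF s] by eventually_elim (meson ereal_less_eq(3) order_trans)
    next
      fix Y' :: "'a \<Rightarrow> ereal"
      assume "\<forall>s\<in>S. AE \<omega> in M. Y' \<omega> \<le> family_esssup M A (\<lambda>a \<omega>. ereal (Z a s \<omega>)) \<omega>"
      then have "AE \<omega> in M. Y' \<omega> \<le> family_esssup M A (\<lambda>a \<omega>. ereal (Z a s' \<omega>)) \<omega>" using s' by blast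
      then show "AE \<omega> in M. Y' \<omega> \<le> ereal (v \<omega>)"
        using upper by eventually_elim (rule order_trans)
    qed
  qed
qed

subsection \<open>Measurability and conditional expectation of payoffs\<close>

lemma borel_measurable_vec_iff:
  fixes f :: "'a \<Rightarrow> real^'n::finite"
  shows "f \<in> borel_measurable N \<longleftrightarrow> (\<forall>k. (\<lambda>\<omega>. f \<omega> $ k) \<in> borel_measurable N)"
  unfolding borel_measurable_euclidean_space[of f]
  by (auto simp: Basis_vec_def inner_axis)

lemma borel_measurable_vec_nth [measurable (raw)]:
  fixes f :: "'a \<Rightarrow> real^'n::finite"
  shows "f \<in> borel_measurable N \<Longrightarrow> (\<lambda>\<omega>. f \<omega> $ k) \<in> borel_measurable N"
  by (simp add: borel_measurable_vec_iff)

text \<open>Measurability, integrability and conditional expectation of payoffs for a fixed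
  \<open>E\<close> all reduce to this form.\<close>

lemma exercise_payoff_affine:
  "\<exists>a b. \<forall>x p. exercise_payoff G E x p k = (\<Sum>l\<in>UNIV. a l * x $ l) + (\<Sum>l\<in>UNIV. b l * p $ l)"
proof (cases "k \<in> E")
  case True
  have "exercise_payoff G E x p k =
      (\<Sum>l\<in>UNIV. (if l = k then 1 else 0) * x $ l) + (\<Sum>l\<in>UNIV. 0 * p $ l)" for x p
  proof -
    have "(\<Sum>l\<in>UNIV. (if l = k then 1 else 0) * x $ l) = (\<Sum>l\<in>UNIV. if l = k then x $ l else 0)"
      by (rule sum.cong) simp_all
    then show ?thesis using True by (simp add: exercise_payoff_def)
  qed
  then show ?thesis
    by (intro exI[of _ "\<lambda>l. if l = k then 1 else 0"] exI[of _ "\<lambda>l. 0"] allI)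
next
  case False
  define c where "c l = (if l \<in> E then \<Sum>j\<in>E. G $ k $ j * principal_inverse G E $ j $ l else 0)" for l
  have "exercise_payoff G E x p k =
      (\<Sum>l\<in>UNIV. c l * x $ l) + (\<Sum>l\<in>UNIV. ((if l = k then 1 else 0) - c l) * p $ l)" for x p
  proof -
    have "(\<Sum>j\<in>E. \<Sum>l\<in>E. G $ k $ j * principal_inverse G E $ j $ l * (x $ l - p $ l)) =
        (\<Sum>l\<in>E. \<Sum>j\<in>E. G $ k $ j * principal_inverse G E $ j $ l * (x $ l - p $ l))"
      by (rule sum.swap)
    also have "\<dots> = (\<Sum>l\<in>E. c l * (x $ l - p $ l))"
      by (rule sum.cong) (simp_all add: c_def sum_distrib_right)
    also have "\<dots> = (\<Sum>l\<in>UNIV. c l * (x $ l - p $ l))"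
      by (rule sum_supported[symmetric]) (simp add: c_def)
    also have "\<dots> = (\<Sum>l\<in>UNIV. c l * x $ l) - (\<Sum>l\<in>UNIV. c l * p $ l)"
      by (simp add: right_diff_distrib sum_subtractf)
    finally have *: "passive_payoff G E x p k = p $ k + ((\<Sum>l\<in>UNIV. c l * x $ l) - (\<Sum>l\<in>UNIV. c l * p $ l))"
      by (simp add: passive_payoff_def)
    have "(\<Sum>l\<in>UNIV. ((if l = k then 1 else 0) - c l) * p $ l) =
        (\<Sum>l\<in>UNIV. (if l = k then p $ l else 0) - c l * p $ l)"
      by (rule sum.cong) (simp_all add: left_diff_distrib)
    also have "\<dots> = p $ k - (\<Sum>l\<in>UNIV. c l * p $ l)"
      by (simp add: sum_subtractf)
    finally show ?thesis using False * by (simp add: exercise_payoff_def)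
  qed
  then show ?thesis
    by (intro exI[of _ c] exI[of _ "\<lambda>l. (if l = k then 1 else 0) - c l"] allI)
qed

lemma borel_measurable_exercise_payoff:
  assumes [measurable]: "x \<in> borel_measurable N" "p \<in> borel_measurable N"
  shows "(\<lambda>\<omega>. exercise_payoff G E (x \<omega>) (p \<omega>) k) \<in> borel_measurable N"
proof -
  obtain a b where ab: "\<And>x p. exercise_payoff G E x p k = (\<Sum>l\<in>UNIV. a l * x $ l) + (\<Sum>l\<in>UNIV. b l * p $ l)"
    using exercise_payoff_affine[of G E k] by blast
  show ?thesis unfolding ab by measurable
qed

lemma integrable_exercise_payoff:
  fixes x p :: "'a \<Rightarrow> real^'n::finite"
  assumes "\<And>l. integrable N (\<lambda>\<omega>. x \<omega> $ l)" "\<And>l. integrable N (\<lambda>\<omega>. p \<omega> $ l)"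
  shows "integrable N (\<lambda>\<omega>. exercise_payoff G E (x \<omega>) (p \<omega>) k)"
proof -
  obtain a b where ab: "\<And>x p. exercise_payoff G E x p k = (\<Sum>l\<in>UNIV. a l * x $ l) + (\<Sum>l\<in>UNIV. b l * p $ l)"
    using exercise_payoff_affine[of G E k] by blast
  show ?thesis unfolding ab using assms by simp
qed

lemma (in sigma_finite_subalgebra) exercise_payoff_cond_exp:
  fixes x p :: "'a \<Rightarrow> real^'n::finite"
  assumes x: "\<And>l. integrable M (\<lambda>\<omega>. x \<omega> $ l)" "x \<in> borel_measurable F"
    and p: "\<And>l. integrable M (\<lambda>\<omega>. p \<omega> $ l)"
  shows "AE \<omega> in M. real_cond_exp M F (\<lambda>\<omega>. exercise_payoff G E (x \<omega>) (p \<omega>) k) \<omega> =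
    exercise_payoff G E (x \<omega>) (vec_cond_exp M F p \<omega>) k"
proof -
  obtain a b where ab: "\<And>x p. exercise_payoff G E x p k = (\<Sum>l\<in>UNIV. a l * x $ l) + (\<Sum>l\<in>UNIV. b l * p $ l)"
    using exercise_payoff_affine[of G E k] by blast
  have "AE \<omega> in M. real_cond_exp M F (\<lambda>\<omega>. (\<Sum>l\<in>UNIV. a l * x \<omega> $ l) + (\<Sum>l\<in>UNIV. b l * p \<omega> $ l)) \<omega> =
    real_cond_exp M F (\<lambda>\<omega>. \<Sum>l\<in>UNIV. a l * x \<omega> $ l) \<omega> + real_cond_exp M F (\<lambda>\<omega>. \<Sum>l\<in>UNIV. b l * p \<omega> $ l) \<omega>"
    by (intro real_cond_exp_add) (use x p in auto)
  moreover have "AE \<omega> in M. real_cond_exp M F (\<lambda>\<omega>. \<Sum>l\<in>UNIV. a l * x \<omega> $ l) \<omega> = (\<Sum>l\<in>UNIV. a l * x \<omega> $ l)"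
    by (intro real_cond_exp_F_meas borel_measurable_sum borel_measurable_times borel_measurable_vec_nth)
      (use x in auto)
  moreover have "AE \<omega> in M. real_cond_exp M F (\<lambda>\<omega>. \<Sum>l\<in>UNIV. b l * p \<omega> $ l) \<omega> =
      (\<Sum>l\<in>UNIV. real_cond_exp M F (\<lambda>\<omega>. b l * p \<omega> $ l) \<omega>)"
    by (intro real_cond_exp_sum) (use p in auto)
  moreover have "AE \<omega> in M. \<forall>l. real_cond_exp M F (\<lambda>\<omega>. b l * p \<omega> $ l) \<omega> = b l * real_cond_exp M F (\<lambda>\<omega>. p \<omega> $ l) \<omega>"
    unfolding AE_all_countable by (intro allI real_cond_exp_cmult p)
  ultimately show ?thesis
    unfolding ab vec_cond_exp_def by eventually_elim simp
qed

text \<open>Whichever \<open>E\<close> is an equilibrium computes \<open>SOL\<close>, so a sublevel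
  set is a finite union of measurable events over \<open>E\<close>.\<close>

lemma borel_measurable_SOL:
  assumes G: "K_dagger G" and x: "x \<in> borel_measurable N" and p: "p \<in> borel_measurable N"
  shows "(\<lambda>\<omega>. SOL (x \<omega>) (p \<omega>) G) \<in> borel_measurable N"
  unfolding borel_measurable_vec_iff
proof (intro allI borel_measurableI_le)
  fix k c
  note x [measurable]
  have payoff [measurable]: "(\<lambda>\<omega>. exercise_payoff G E (x \<omega>) (p \<omega>) l) \<in> borel_measurable N" for E l
    by (rule borel_measurable_exercise_payoff[OF x p])
  have nash: "nash_set (x \<omega>) (p \<omega>) G E \<longleftrightarrow>
     (\<forall>i\<in>E. exercise_payoff G (E - {i}) (x \<omega>) (p \<omega>) i \<le> x \<omega> $ i) \<and>
     (\<forall>i\<in>-E. x \<omega> $ i \<le> exercise_payoff G E (x \<omega>) (p \<omega>) i)" for \<omega> E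
    by (auto simp: nash_set_def exercise_payoff_def)
  have [measurable]: "Measurable.pred N (\<lambda>\<omega>. nash_set (x \<omega>) (p \<omega>) G E)" for E
    unfolding nash by measurable
  have "{\<omega> \<in> space N. SOL (x \<omega>) (p \<omega>) G $ k \<le> c} =
      {\<omega> \<in> space N. \<exists>E\<in>UNIV. nash_set (x \<omega>) (p \<omega>) G E \<and> exercise_payoff G E (x \<omega>) (p \<omega>) k \<le> c}"
  proof (intro Collect_cong conj_cong refl)
    fix \<omega>
    show "SOL (x \<omega>) (p \<omega>) G $ k \<le> c \<longleftrightarrow>
      (\<exists>E\<in>UNIV. nash_set (x \<omega>) (p \<omega>) G E \<and> exercise_payoff G E (x \<omega>) (p \<omega>) k \<le> c)"
    proof
      assume le: "SOL (x \<omega>) (p \<omega>) G $ k \<le> c"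
      obtain E where "nash_set (x \<omega>) (p \<omega>) G E" using nash_set_exists[OF G] by blast
      then show "\<exists>E\<in>UNIV. nash_set (x \<omega>) (p \<omega>) G E \<and> exercise_payoff G E (x \<omega>) (p \<omega>) k \<le> c"
        using le SOL_nash[OF G] by auto
    qed (auto simp: SOL_nash[OF G])
  qed
  also have "\<dots> \<in> sets N" by measurable
  finally show "{\<omega> \<in> space N. SOL (x \<omega>) (p \<omega>) G $ k \<le> c} \<in> sets N" .
qed

text \<open>At each point the solution is one of finitely many exercise payoffs, so the sum of their
  absolute values is an integrable bound.\<close>

lemma integrable_SOL:
  assumes G: "K_dagger G" and x: "x \<in> borel_measurable N" "\<And>l. integrable N (\<lambda>\<omega>. x \<omega> $ l)"
    and p: "p \<in> borel_measurable N" "\<And>l. integrable N (\<lambda>\<omega>. p \<omega> $ l)"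
  shows "integrable N (\<lambda>\<omega>. SOL (x \<omega>) (p \<omega>) G $ k)"
proof (rule Bochner_Integration.integrable_bound)
  show "integrable N (\<lambda>\<omega>. \<Sum>E\<in>UNIV. \<bar>exercise_payoff G E (x \<omega>) (p \<omega>) k\<bar>)"
    by (intro Bochner_Integration.integrable_sum integrable_abs integrable_exercise_payoff x p)
  show "(\<lambda>\<omega>. SOL (x \<omega>) (p \<omega>) G $ k) \<in> borel_measurable N"
    by (intro borel_measurable_vec_nth borel_measurable_SOL[OF G x(1) p(1)])
  show "AE \<omega> in N. norm (SOL (x \<omega>) (p \<omega>) G $ k) \<le> norm (\<Sum>E\<in>UNIV. \<bar>exercise_payoff G E (x \<omega>) (p \<omega>) k\<bar>)"
  proof (rule AE_I2)
    fix \<omega>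
    obtain E where "nash_set (x \<omega>) (p \<omega>) G E" using nash_set_exists[OF G] by blast
    then have "norm (SOL (x \<omega>) (p \<omega>) G $ k) = \<bar>exercise_payoff G E (x \<omega>) (p \<omega>) k\<bar>"
      by (simp add: SOL_nash[OF G])
    also have "\<dots> \<le> (\<Sum>E\<in>UNIV. \<bar>exercise_payoff G E (x \<omega>) (p \<omega>) k\<bar>)"
      by (rule member_le_sum) simp_all
    also have "\<dots> \<le> norm (\<Sum>E\<in>UNIV. \<bar>exercise_payoff G E (x \<omega>) (p \<omega>) k\<bar>)" by simp
    finally show "norm (SOL (x \<omega>) (p \<omega>) G $ k) \<le> norm (\<Sum>E\<in>UNIV. \<bar>exercise_payoff G E (x \<omega>) (p \<omega>) k\<bar>)" .
  qed
qed

lemma game_end_le: "game_end s \<omega> \<le> s i \<omega>"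
  by (simp add: game_end_def)

lemma le_game_end_iff: "u \<le> game_end s \<omega> \<longleftrightarrow> (\<forall>i. u \<le> s i \<omega>)"
  by (simp add: game_end_def)

lemma game_end_attained: "\<exists>i. s i \<omega> = game_end s \<omega>"
proof -
  have "game_end s \<omega> \<in> range (\<lambda>i. s i \<omega>)" unfolding game_end_def by (rule Min_in) auto
  then show ?thesis by auto
qed

subsection \<open>The multi-period game\<close>

lemma borel_measurable_vec_cond_exp [measurable]: "vec_cond_exp M H Y \<in> borel_measurable H"
  by (simp add: borel_measurable_vec_iff vec_cond_exp_def)

lemma integrable_indicator_times:
  fixes f :: "'a \<Rightarrow> real"
  assumes "A \<in> sets M" "integrable M f" shows "integrable M (\<lambda>x. indicator A x * f x)"
  using integrable_mult_indicator[OF assms] by simp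

locale stochastic_affine_game = prob_space M + filtration "space M" F
  for M :: "'a measure" and F :: "nat \<Rightarrow> 'a measure" +
  fixes T :: nat and X :: "nat \<Rightarrow> 'a \<Rightarrow> real^'n::finite" and G :: "real^'n^'n"
  assumes subalg: "t \<le> T \<Longrightarrow> subalgebra M (F t)"
    and X_adapted: "t \<le> T \<Longrightarrow> X t \<in> borel_measurable (F t)"
    and X_integrable: "t \<le> T \<Longrightarrow> integrable M (X t)"
    and G: "K_dagger G"
begin

lemma sigma_finite_F: "t \<le> T \<Longrightarrow> sigma_finite_subalgebra M (F t)"
  by (intro finite_measure_subalgebra_is_sigma_finite) (unfold_locales, rule subalg)

lemma subalgebra_F: "t \<le> u \<Longrightarrow> subalgebra (F u) (F t)"
  by (simp add: subalgebra_def space_F sets_F_mono)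

lemma X_nth_integrable: "t \<le> T \<Longrightarrow> integrable M (\<lambda>\<omega>. X t \<omega> $ k)"
  using integrable_bounded_linear[OF bounded_linear_vec_nth X_integrable] .

lemma SOL_process_exists: "\<exists>U. SOL_process M F T X G U"
proof -
  \<comment> \<open>\<open>W n\<close> is the process at time \<open>T - n\<close>; reversing time
    makes the backward recursion primitive.\<close>
  define W where "W = rec_nat (X T)
    (\<lambda>n w \<omega>. SOL (X (T - Suc n) \<omega>) (vec_cond_exp M (F (T - Suc n)) w \<omega>) G)"
  have W0: "W 0 = X T" by (simp add: W_def)
  have WS: "W (Suc n) = (\<lambda>\<omega>. SOL (X (T - Suc n) \<omega>) (vec_cond_exp M (F (T - Suc n)) (W n) \<omega>) G)" for n
    by (simp add: W_def)
  have rec: "W (T - t) = (\<lambda>\<omega>. SOL (X t \<omega>) (vec_cond_exp M (F t) (W (T - (t + 1))) \<omega>) G)" if "t < T" for t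
  proof -
    have "T - t = Suc (T - (t + 1))" "T - Suc (T - (t + 1)) = t" using that by auto
    then show ?thesis using WS[of "T - (t + 1)"] by simp
  qed
  have "W (T - t) \<in> borel_measurable (F t)" if "t \<le> T" for t
  proof (cases "t = T")
    case True
    then show ?thesis using X_adapted W0 by simp
  next
    case False
    then have "t < T" using that by simp
    then show ?thesis
      using that by (subst rec) (auto intro!: borel_measurable_SOL G X_adapted)
  qed
  then show ?thesis
    using rec by (intro exI[of _ "\<lambda>t. W (T - t)"]) (simp add: SOL_process_def W0)
qed

section \<open>Exercise events and the pathwise form of the reward\<close>

lemma stopping_time_events:
  assumes "\<sigma> \<in> stopping_times M F T t"
  shows "Measurable.pred (F u) (\<lambda>\<omega>. u \<le> \<sigma> \<omega>)" "Measurable.pred (F u) (\<lambda>\<omega>. \<sigma> \<omega> = u)"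
proof -
  have st: "stopping_time F \<sigma>" using assms by (simp add: stopping_times_def)
  have [measurable]: "Measurable.pred (F u) (\<lambda>\<omega>. \<sigma> \<omega> \<le> u)" by (rule stopping_timeD[OF st])
  show ge [measurable]: "Measurable.pred (F u) (\<lambda>\<omega>. u \<le> \<sigma> \<omega>)"
  proof (cases u)
    case (Suc n)
    have [measurable]: "Measurable.pred (F u) (\<lambda>\<omega>. \<sigma> \<omega> \<le> n)"
      by (rule stopping_time_le_const[OF st]) (simp add: Suc)
    have "(\<lambda>\<omega>. u \<le> \<sigma> \<omega>) = (\<lambda>\<omega>. \<not> \<sigma> \<omega> \<le> n)" by (auto simp: Suc)
    then show ?thesis by simp
  qed simp
  have "(\<lambda>\<omega>. \<sigma> \<omega> = u) = (\<lambda>\<omega>. \<sigma> \<omega> \<le> u \<and> u \<le> \<sigma> \<omega>)" by auto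
  then show "Measurable.pred (F u) (\<lambda>\<omega>. \<sigma> \<omega> = u)" by simp
qed

text \<open>For nonempty \<open>E\<close> the game ends at \<open>u\<close> with exercisers
  \<open>E\<close>; for \<open>E = {}\<close> it goes on past \<open>u\<close>. Being
  \<open>F u\<close>-measurable, these events can be taken out of conditional expectations given
  \<open>F u\<close>.\<close>

definition alive :: "('n \<Rightarrow> 'a \<Rightarrow> nat) \<Rightarrow> nat \<Rightarrow> 'n set \<Rightarrow> 'a set" where
  "alive s u E = {\<omega> \<in> space M. u \<le> game_end s \<omega> \<and> {i. s i \<omega> = u} = E}"

lemma alive_in_F:
  assumes "s \<in> SAG_profiles M F T t" shows "alive s u E \<in> sets (F u)"
proof -
  have [measurable]: "Measurable.pred (F u) (\<lambda>\<omega>. u \<le> s i \<omega>)" "Measurable.pred (F u) (\<lambda>\<omega>. s i \<omega> = u)" for i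
    using assms stopping_time_events[of "s i" t u] by (auto simp: SAG_profiles_def)
  have "alive s u E = {\<omega> \<in> space (F u). \<forall>i. u \<le> s i \<omega> \<and> (s i \<omega> = u \<longleftrightarrow> i \<in> E)}"
    by (auto simp: alive_def le_game_end_iff space_F)
  also have "\<dots> \<in> sets (F u)" by measurable
  finally show ?thesis .
qed

lemma SAG_profiles_range:
  assumes "s \<in> SAG_profiles M F T t" "\<omega> \<in> space M" shows "s i \<omega> \<in> {t..T}"
proof -
  have "s i \<in> stopping_times M F T t" using assms(1) unfolding SAG_profiles_def by blast
  then show ?thesis using assms(2) unfolding stopping_times_def by blast
qed

lemma game_end_in:
  assumes "s \<in> SAG_profiles M F T t" "\<omega> \<in> space M" shows "game_end s \<omega> \<in> {t..T}"
proof -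
  obtain i where i: "s i \<omega> = game_end s \<omega>" using game_end_attained[of s \<omega>] ..
  show ?thesis using SAG_profiles_range[OF assms, of i] unfolding i .
qed

lemma exercisers_at_T:
  assumes "s \<in> SAG_profiles M F T t" "\<omega> \<in> space M" "game_end s \<omega> = T"
  shows "exercisers s \<omega> = UNIV"
proof -
  have "s i \<omega> = T" for i
  proof (rule antisym)
    show "s i \<omega> \<le> T" using SAG_profiles_range[OF assms(1,2), of i] by simp
    show "T \<le> s i \<omega>" using game_end_le[of s \<omega> i] assms by simp
  qed
  then show ?thesis using assms by (simp add: exercisers_def)
qed

definition reward :: "(nat \<Rightarrow> 'a \<Rightarrow> real^'n) \<Rightarrow> ('n \<Rightarrow> 'a \<Rightarrow> nat) \<Rightarrow> 'n \<Rightarrow> 'a \<Rightarrow> real" where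
  "reward V s k \<omega> = exercise_payoff G (exercisers s \<omega>) (X (game_end s \<omega>) \<omega>) (V (game_end s \<omega> + 1) \<omega>) k"

lemma SAG_outcome_eq: "SAG_outcome M F X G V t s k = real_cond_exp M (F t) (reward V s k)"
  unfolding SAG_outcome_def reward_def[abs_def] exercise_payoff_def ..

text \<open>Only the term with \<open>u\<close> the end of the game and \<open>E\<close> the
  exercisers survives; none does if the game ends at \<open>T\<close>, where everyone receives
  \<open>X T\<close>. The finite sum yields measurability and shows which \<open>V u\<close>
  enter.\<close>

lemma reward_decomp:
  assumes s: "s \<in> SAG_profiles M F T t" and \<omega>: "\<omega> \<in> space M"
  shows "reward V s k \<omega> = X T \<omega> $ k +
    (\<Sum>u\<in>{t..<T}. \<Sum>E\<in>UNIV - {{}}. indicator (alive s u E) \<omega> * (exercise_payoff G E (X u \<omega>) (V (u + 1) \<omega>) k - X T \<omega> $ k))"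
proof -
  let ?v = "game_end s \<omega>"
  have v: "?v \<in> {t..T}" by (rule game_end_in[OF s \<omega>])
  have inner: "(\<Sum>E\<in>UNIV - {{}}. indicator (alive s u E) \<omega> * (exercise_payoff G E (X u \<omega>) (V (u + 1) \<omega>) k - X T \<omega> $ k))
      = (if u = ?v then reward V s k \<omega> - X T \<omega> $ k else 0)" for u
  proof (cases "u = ?v")
    case True
    have ne: "exercisers s \<omega> \<noteq> {}" using game_end_attained[of s \<omega>] by (auto simp: exercisers_def)
    have ind: "indicator (alive s ?v E) \<omega> = (if E = exercisers s \<omega> then 1 else 0::real)" for E
      using \<omega> by (auto simp: alive_def exercisers_def indicator_def)
    have "(\<Sum>E\<in>UNIV - {{}}. indicator (alive s u E) \<omega> * (exercise_payoff G E (X u \<omega>) (V (u + 1) \<omega>) k - X T \<omega> $ k))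
       = (\<Sum>E\<in>UNIV - {{}}. if E = exercisers s \<omega> then reward V s k \<omega> - X T \<omega> $ k else 0)"
      by (rule sum.cong) (simp_all add: ind reward_def True)
    also have "\<dots> = reward V s k \<omega> - X T \<omega> $ k" using ne by (simp add: sum.delta)
    finally show ?thesis using True by simp
  next
    case False
    have "indicator (alive s u E) \<omega> = (0::real)" if "E \<noteq> {}" for E
    proof -
      have "\<omega> \<notin> alive s u E"
      proof
        assume "\<omega> \<in> alive s u E"
        then have "u \<le> ?v" "\<exists>i. s i \<omega> = u" using that by (auto simp: alive_def)
        then show False using False game_end_le[of s \<omega>] by (metis antisym)
      qed
      then show ?thesis by simp
    qed
    then have "(\<Sum>E\<in>UNIV - {{}}. indicator (alive s u E) \<omega> * (exercise_payoff G E (X u \<omega>) (V (u + 1) \<omega>) k - X T \<omega> $ k)) = 0"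
      by (intro sum.neutral) simp
    then show ?thesis using False by simp
  qed
  show ?thesis
  proof (cases "?v = T")
    case True
    then have "reward V s k \<omega> = X T \<omega> $ k"
      using exercisers_at_T[OF s \<omega>] by (simp add: reward_def exercise_payoff_def)
    then show ?thesis unfolding inner by simp
  next
    case False
    then have "?v \<in> {t..<T}" using v by auto
    then show ?thesis unfolding inner by (simp add: sum.delta)
  qed
qed

lemma measurable_alive: "s \<in> SAG_profiles M F T t \<Longrightarrow> u \<le> T \<Longrightarrow> alive s u E \<in> sets M"
  using alive_in_F[of s t u E] subalg[of u] by (auto simp: subalgebra_def)

lemma X_measurable: "t \<le> T \<Longrightarrow> X t \<in> borel_measurable M"
  by (rule measurable_from_subalg[OF subalg X_adapted])

lemma borel_measurable_reward:
  assumes s: "s \<in> SAG_profiles M F T t" and V: "\<And>u. t < u \<Longrightarrow> u \<le> T \<Longrightarrow> V u \<in> borel_measurable M"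
  shows "reward V s k \<in> borel_measurable M"
proof -
  have "(\<lambda>\<omega>. X T \<omega> $ k + (\<Sum>u\<in>{t..<T}. \<Sum>E\<in>UNIV - {{}}. indicator (alive s u E) \<omega> *
      (exercise_payoff G E (X u \<omega>) (V (u + 1) \<omega>) k - X T \<omega> $ k))) \<in> borel_measurable M"
    using V by (intro borel_measurable_add borel_measurable_sum borel_measurable_times borel_measurable_diff
      borel_measurable_vec_nth borel_measurable_exercise_payoff X_measurable borel_measurable_indicator
      measurable_alive[OF s]) auto
  then show ?thesis
    by (subst measurable_cong[OF reward_decomp[OF s]])
qed

text \<open>Values are determined only almost surely, so outcomes must not depend on the version;
  the null sets of the finitely many times after \<open>t\<close> are combined.\<close>

lemma SAG_outcome_cong:
  assumes s: "s \<in> SAG_profiles M F T t" and t: "t \<le> T"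
    and V: "\<And>u. t < u \<Longrightarrow> u \<le> T \<Longrightarrow> V u \<in> borel_measurable M"
    and W: "\<And>u. t < u \<Longrightarrow> u \<le> T \<Longrightarrow> W u \<in> borel_measurable M"
    and VW: "\<And>u. t < u \<Longrightarrow> u \<le> T \<Longrightarrow> AE \<omega> in M. V u \<omega> = W u \<omega>"
  shows "AE \<omega> in M. SAG_outcome M F X G V t s k \<omega> = SAG_outcome M F X G W t s k \<omega>"
  unfolding SAG_outcome_eq
proof (rule sigma_finite_subalgebra.real_cond_exp_cong[OF sigma_finite_F[OF t]])
  have "AE \<omega> in M. \<forall>u\<in>{t<..T}. V u \<omega> = W u \<omega>"
    using VW by (subst AE_ball_countable) auto
  then show "AE \<omega> in M. reward V s k \<omega> = reward W s k \<omega>"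
    using AE_space[of M]
  proof eventually_elim
    case (elim \<omega>)
    show ?case
      unfolding reward_decomp[OF s elim(2)] using elim(1) by (auto intro!: sum.cong)
  qed
qed (use borel_measurable_reward[OF s] V W in auto)

end

section \<open>Increments of the reward along the solution process\<close>

locale solved_affine_game = stochastic_affine_game M F T X G
  for M :: "'a measure" and F :: "nat \<Rightarrow> 'a measure" and T :: nat
    and X :: "nat \<Rightarrow> 'a \<Rightarrow> real^'n::finite" and G :: "real^'n^'n" +
  fixes U :: "nat \<Rightarrow> 'a \<Rightarrow> real^'n"
  assumes SOL_process: "SOL_process M F T X G U"
begin

abbreviation continuation :: "nat \<Rightarrow> 'a \<Rightarrow> real^'n" where
  "continuation u \<equiv> vec_cond_exp M (F u) (U (u + 1))"

lemma U_adapted: "t \<le> T \<Longrightarrow> U t \<in> borel_measurable (F t)"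
  using SOL_process by (simp add: SOL_process_def)

lemma U_measurable: "t \<le> T \<Longrightarrow> U t \<in> borel_measurable M"
  by (rule measurable_from_subalg[OF subalg U_adapted])

lemma U_terminal: "\<omega> \<in> space M \<Longrightarrow> U T \<omega> = X T \<omega>"
  using SOL_process by (simp add: SOL_process_def)

lemma U_SOL: "t < T \<Longrightarrow> AE \<omega> in M. U t \<omega> = SOL (X t \<omega>) (continuation t \<omega>) G"
  using SOL_process by (simp add: SOL_process_def)

lemma continuation_measurable: "t \<le> T \<Longrightarrow> continuation t \<in> borel_measurable M"
  by (rule measurable_from_subalg[OF subalg borel_measurable_vec_cond_exp])

lemma U_integrable: "t \<le> T \<Longrightarrow> integrable M (\<lambda>\<omega>. U t \<omega> $ k)"
proof (induction arbitrary: k rule: inc_induct)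
  case base
  have "integrable M (\<lambda>\<omega>. U T \<omega> $ k) \<longleftrightarrow> integrable M (\<lambda>\<omega>. X T \<omega> $ k)"
    by (rule Bochner_Integration.integrable_cong) (simp_all add: U_terminal)
  then show ?case using X_nth_integrable by simp
next
  case (step t)
  interpret Ft: sigma_finite_subalgebra M "F t" using step by (intro sigma_finite_F) simp
  have t: "t \<le> T" using step by simp
  have "integrable M (\<lambda>\<omega>. continuation t \<omega> $ l)" for l
    unfolding vec_cond_exp_def using Ft.real_cond_exp_int(1) step.IH by simp
  then have "integrable M (\<lambda>\<omega>. SOL (X t \<omega>) (continuation t \<omega>) G $ k)"
    by (intro integrable_SOL G X_measurable X_nth_integrable continuation_measurable t)
  moreover have "(\<lambda>\<omega>. U t \<omega> $ k) \<in> borel_measurable M"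
    by (intro borel_measurable_vec_nth U_measurable t)
  moreover have "AE \<omega> in M. SOL (X t \<omega>) (continuation t \<omega>) G $ k = U t \<omega> $ k"
    using U_SOL[OF \<open>t < T\<close>] by eventually_elim simp
  ultimately show ?case by (rule integrable_cong_AE_imp)
qed

lemma continuation_integrable:
  assumes "t < T" shows "integrable M (\<lambda>\<omega>. continuation t \<omega> $ k)"
proof -
  interpret Ft: sigma_finite_subalgebra M "F t" using assms by (intro sigma_finite_F) simp
  show ?thesis unfolding vec_cond_exp_def using Ft.real_cond_exp_int(1) U_integrable[of "t + 1"] assms by simp
qed

text \<open>On \<open>alive s u {}\<close> nobody exercises at time \<open>u\<close>, and since
  \<open>exercise_payoff G {} x p k = p $ k\<close>, one formula covers both continuing and stopping.\<close>

definition gain :: "('a \<Rightarrow> real^'n) \<Rightarrow> ('n \<Rightarrow> 'a \<Rightarrow> nat) \<Rightarrow> 'n \<Rightarrow> nat \<Rightarrow> 'a \<Rightarrow> real" where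
  "gain W s k u \<omega> = (\<Sum>E\<in>UNIV. indicator (alive s u E) \<omega> * (exercise_payoff G E (X u \<omega>) (W \<omega>) k - U u \<omega> $ k))"

lemma gain_eq:
  assumes "\<omega> \<in> space M"
  shows "gain W s k u \<omega> = (if u \<le> game_end s \<omega>
    then exercise_payoff G {i. s i \<omega> = u} (X u \<omega>) (W \<omega>) k - U u \<omega> $ k else 0)"
proof -
  have "indicator (alive s u E) \<omega> = (if E = {i. s i \<omega> = u} then if u \<le> game_end s \<omega> then 1 else 0 else 0::real)" for E
    using assms by (auto simp: alive_def indicator_def)
  then have "gain W s k u \<omega> = (\<Sum>E\<in>UNIV. if E = {i. s i \<omega> = u} then (if u \<le> game_end s \<omega>
    then exercise_payoff G E (X u \<omega>) (W \<omega>) k - U u \<omega> $ k else 0) else 0)"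
    unfolding gain_def by (intro sum.cong) simp_all
  then show ?thesis by simp
qed

text \<open>Before the end each gain is an increment of \<open>U\<close>, at the end it is the
  reward minus \<open>U\<close>, afterwards zero, so the sum telescopes. At time \<open>T\<close> no
  gain is counted and \<open>U T = X T\<close> fills in.\<close>

lemma reward_telescope:
  assumes s: "s \<in> SAG_profiles M F T t" and \<omega>: "\<omega> \<in> space M"
  shows "reward U s k \<omega> = U t \<omega> $ k + (\<Sum>u\<in>{t..<T}. gain (U (u + 1)) s k u \<omega>)"
proof -
  let ?v = "game_end s \<omega>"
  have v: "t \<le> ?v" "?v \<le> T" using game_end_in[OF s \<omega>] by auto
  have before: "gain (U (u + 1)) s k u \<omega> = U (u + 1) \<omega> $ k - U u \<omega> $ k" if "u < ?v" for u
  proof -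
    have "{i. s i \<omega> = u} = {}" using that game_end_le[of s \<omega>] by (auto simp: leD)
    then show ?thesis using that by (simp add: gain_eq[OF \<omega>] exercise_payoff_def)
  qed
  have after: "gain (U (u + 1)) s k u \<omega> = 0" if "?v < u" for u
    using that by (simp add: gain_eq[OF \<omega>])
  have sum_before: "(\<Sum>u\<in>{t..<?v}. gain (U (u + 1)) s k u \<omega>) = U ?v \<omega> $ k - U t \<omega> $ k"
    using before sum_Suc_diff'[OF v(1), of "\<lambda>u. U u \<omega> $ k"] by simp
  show ?thesis
  proof (cases "?v = T")
    case True
    then have "reward U s k \<omega> = U T \<omega> $ k"
      using exercisers_at_T[OF s \<omega>] by (simp add: reward_def exercise_payoff_def U_terminal[OF \<omega>])
    then show ?thesis using sum_before True by simp
  next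
    case False
    then have "?v < T" using v by simp
    have "(\<Sum>u\<in>{t..<T}. gain (U (u + 1)) s k u \<omega>) =
        (\<Sum>u\<in>{t..<?v}. gain (U (u + 1)) s k u \<omega>) + (\<Sum>u\<in>{?v..<T}. gain (U (u + 1)) s k u \<omega>)"
      using v by (simp add: sum.atLeastLessThan_concat)
    also have "(\<Sum>u\<in>{?v..<T}. gain (U (u + 1)) s k u \<omega>) = gain (U (?v + 1)) s k ?v \<omega>"
      using \<open>?v < T\<close> after by (subst sum.atLeast_Suc_lessThan) auto
    also have "\<dots> = reward U s k \<omega> - U ?v \<omega> $ k"
      by (simp add: gain_eq[OF \<omega>] reward_def exercisers_def)
    finally show ?thesis using sum_before by simp
  qed
qed

lemma gain_integrable:
  assumes s: "s \<in> SAG_profiles M F T t" and u: "u < T" and W: "\<And>l. integrable M (\<lambda>\<omega>. W \<omega> $ l)"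
  shows "integrable M (gain W s k u)"
  unfolding gain_def[abs_def]
  by (intro Bochner_Integration.integrable_sum integrable_indicator_times measurable_alive[OF s]
    Bochner_Integration.integrable_diff integrable_exercise_payoff X_nth_integrable U_integrable W)
   (use u in auto)

text \<open>For each fixed \<open>E\<close> the indicator of \<open>alive s u E\<close> and
  \<open>U u\<close> are known at time \<open>u\<close>, and the payoff is affine in the
  continuation value. The sum over \<open>E\<close> thus handles the random exercising set.\<close>

lemma gain_cond_exp:
  assumes s: "s \<in> SAG_profiles M F T t" and u: "u < T"
  shows "AE \<omega> in M. real_cond_exp M (F u) (gain (U (u + 1)) s k u) \<omega> = gain (continuation u) s k u \<omega>"
proof -
  interpret Fu: sigma_finite_subalgebra M "F u" using u by (intro sigma_finite_F) simp
  have u': "u \<le> T" "u + 1 \<le> T" using u by auto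
  let ?f = "\<lambda>E \<omega>. exercise_payoff G E (X u \<omega>) (U (u + 1) \<omega>) k - U u \<omega> $ k"
  let ?g = "\<lambda>E \<omega>. indicator (alive s u E) \<omega> * ?f E \<omega>"
  have int_payoff: "integrable M (\<lambda>\<omega>. exercise_payoff G E (X u \<omega>) (U (u + 1) \<omega>) k)" for E
    by (intro integrable_exercise_payoff X_nth_integrable U_integrable u')
  then have int_f: "integrable M (?f E)" for E
    by (intro Bochner_Integration.integrable_diff U_integrable u')
  have int_g: "integrable M (?g E)" for E
    by (intro integrable_indicator_times int_f measurable_alive[OF s u'(1)])
  have "AE \<omega> in M. real_cond_exp M (F u) (\<lambda>\<omega>. \<Sum>E\<in>UNIV. ?g E \<omega>) \<omega> =
      (\<Sum>E\<in>UNIV. real_cond_exp M (F u) (?g E) \<omega>)"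
    by (rule Fu.real_cond_exp_sum[OF int_g])
  moreover have "AE \<omega> in M. \<forall>E. real_cond_exp M (F u) (?g E) \<omega> = indicator (alive s u E) \<omega> *
      (exercise_payoff G E (X u \<omega>) (continuation u \<omega>) k - U u \<omega> $ k)"
    unfolding AE_all_countable
  proof
    fix E
    have "AE \<omega> in M. real_cond_exp M (F u) (?g E) \<omega> = indicator (alive s u E) \<omega> * real_cond_exp M (F u) (?f E) \<omega>"
      using alive_in_F[OF s] int_f int_g
      by (intro Fu.real_cond_exp_mult borel_measurable_indicator) auto
    moreover have "AE \<omega> in M. real_cond_exp M (F u) (?f E) \<omega> =
        real_cond_exp M (F u) (\<lambda>\<omega>. exercise_payoff G E (X u \<omega>) (U (u + 1) \<omega>) k) \<omega> -
        real_cond_exp M (F u) (\<lambda>\<omega>. U u \<omega> $ k) \<omega>"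
      by (intro Fu.real_cond_exp_diff int_payoff U_integrable u')
    moreover have "AE \<omega> in M. real_cond_exp M (F u) (\<lambda>\<omega>. U u \<omega> $ k) \<omega> = U u \<omega> $ k"
      by (intro Fu.real_cond_exp_F_meas U_integrable u' borel_measurable_vec_nth U_adapted)
    moreover have "AE \<omega> in M. real_cond_exp M (F u) (\<lambda>\<omega>. exercise_payoff G E (X u \<omega>) (U (u + 1) \<omega>) k) \<omega> =
        exercise_payoff G E (X u \<omega>) (continuation u \<omega>) k"
      by (intro Fu.exercise_payoff_cond_exp X_nth_integrable X_adapted U_integrable u')
    ultimately show "AE \<omega> in M. real_cond_exp M (F u) (?g E) \<omega> = indicator (alive s u E) \<omega> *
      (exercise_payoff G E (X u \<omega>) (continuation u \<omega>) k - U u \<omega> $ k)"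
      by eventually_elim simp
  qed
  ultimately show ?thesis
    unfolding gain_def[abs_def] by eventually_elim simp
qed

text \<open>Conditioning the telescoped reward on \<open>F t\<close> through \<open>F u\<close>, by
  the tower property, turns each gain into its one-step conditional form, whose sign the
  single-period game controls.\<close>

lemma outcome_decomp:
  assumes s: "s \<in> SAG_profiles M F T t" and t: "t \<le> T"
  shows "AE \<omega> in M. SAG_outcome M F X G U t s k \<omega> =
    U t \<omega> $ k + (\<Sum>u\<in>{t..<T}. real_cond_exp M (F t) (gain (continuation u) s k u) \<omega>)"
proof -
  interpret Ft: sigma_finite_subalgebra M "F t" by (rule sigma_finite_F[OF t])
  \<comment> \<open>Gains are set to zero outside \<open>{t..<T}\<close> because the summation rule
    for conditional expectations asks for integrability at every index.\<close>
  let ?D = "\<lambda>u \<omega>. if u \<in> {t..<T} then gain (U (u + 1)) s k u \<omega> else 0"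
  have D_int: "integrable M (?D u)" for u
    using gain_integrable[OF s, of u "U (u + 1)" k] U_integrable[of "u + 1"] by (cases "u \<in> {t..<T}") auto
  have sum_int: "integrable M (\<lambda>\<omega>. \<Sum>u\<in>{t..<T}. ?D u \<omega>)"
    by (intro Bochner_Integration.integrable_sum D_int)
  have "AE \<omega> in M. real_cond_exp M (F t) (reward U s k) \<omega> =
      real_cond_exp M (F t) (\<lambda>\<omega>. U t \<omega> $ k + (\<Sum>u\<in>{t..<T}. ?D u \<omega>)) \<omega>"
  proof (rule Ft.real_cond_exp_cong)
    show "AE \<omega> in M. reward U s k \<omega> = U t \<omega> $ k + (\<Sum>u\<in>{t..<T}. ?D u \<omega>)"
      by (rule AE_I2) (simp add: reward_telescope[OF s])
    show "reward U s k \<in> borel_measurable M"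
      by (intro borel_measurable_reward[OF s] U_measurable)
    show "(\<lambda>\<omega>. U t \<omega> $ k + (\<Sum>u\<in>{t..<T}. ?D u \<omega>)) \<in> borel_measurable M"
      using sum_int U_integrable[OF t] by (intro borel_measurable_add) auto
  qed
  moreover have "AE \<omega> in M. real_cond_exp M (F t) (\<lambda>\<omega>. U t \<omega> $ k + (\<Sum>u\<in>{t..<T}. ?D u \<omega>)) \<omega> =
      real_cond_exp M (F t) (\<lambda>\<omega>. U t \<omega> $ k) \<omega> + real_cond_exp M (F t) (\<lambda>\<omega>. \<Sum>u\<in>{t..<T}. ?D u \<omega>) \<omega>"
    by (intro Ft.real_cond_exp_add U_integrable t sum_int)
  moreover have "AE \<omega> in M. real_cond_exp M (F t) (\<lambda>\<omega>. U t \<omega> $ k) \<omega> = U t \<omega> $ k"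
    by (intro Ft.real_cond_exp_F_meas U_integrable t borel_measurable_vec_nth U_adapted)
  moreover have "AE \<omega> in M. real_cond_exp M (F t) (\<lambda>\<omega>. \<Sum>u\<in>{t..<T}. ?D u \<omega>) \<omega> =
      (\<Sum>u\<in>{t..<T}. real_cond_exp M (F t) (?D u) \<omega>)"
    by (rule Ft.real_cond_exp_sum[OF D_int])
  moreover have "AE \<omega> in M. \<forall>u\<in>{t..<T}. real_cond_exp M (F t) (?D u) \<omega> =
      real_cond_exp M (F t) (gain (continuation u) s k u) \<omega>"
  proof (subst AE_ball_countable, simp, intro ballI)
    fix u assume u: "u \<in> {t..<T}"
    then have uT: "u < T" "u \<le> T" "t \<le> u" by auto
    interpret Fu: sigma_finite_subalgebra M "F u" using uT by (intro sigma_finite_F)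
    have int: "integrable M (gain (U (u + 1)) s k u)"
      using uT by (intro gain_integrable[OF s] U_integrable) auto
    have "AE \<omega> in M. real_cond_exp M (F t) (real_cond_exp M (F u) (gain (U (u + 1)) s k u)) \<omega> =
        real_cond_exp M (F t) (gain (U (u + 1)) s k u) \<omega>"
      by (intro Ft.real_cond_exp_nested_subalg subalg subalgebra_F uT int)
    moreover have "AE \<omega> in M. real_cond_exp M (F t) (real_cond_exp M (F u) (gain (U (u + 1)) s k u)) \<omega> =
        real_cond_exp M (F t) (gain (continuation u) s k u) \<omega>"
      using gain_integrable[OF s uT(1) continuation_integrable[OF uT(1)]]
      by (intro Ft.real_cond_exp_cong gain_cond_exp[OF s uT(1)]) auto
    ultimately have "AE \<omega> in M. real_cond_exp M (F t) (gain (U (u + 1)) s k u) \<omega> =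
      real_cond_exp M (F t) (gain (continuation u) s k u) \<omega>"
      by eventually_elim simp
    then show "AE \<omega> in M. real_cond_exp M (F t) (?D u) \<omega> =
      real_cond_exp M (F t) (gain (continuation u) s k u) \<omega>"
      using u by simp
  qed
  ultimately show ?thesis
    unfolding SAG_outcome_eq by eventually_elim simp
qed

lemma outcome_ge:
  assumes s: "s \<in> SAG_profiles M F T t" and t: "t \<le> T"
    and gain: "\<And>u. u \<in> {t..<T} \<Longrightarrow> AE \<omega> in M. gain (continuation u) s k u \<omega> \<ge> 0"
  shows "AE \<omega> in M. SAG_outcome M F X G U t s k \<omega> \<ge> U t \<omega> $ k"
proof -
  interpret Ft: sigma_finite_subalgebra M "F t" by (rule sigma_finite_F[OF t])
  have "AE \<omega> in M. \<forall>u\<in>{t..<T}. real_cond_exp M (F t) (gain (continuation u) s k u) \<omega> \<ge> 0"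
  proof (subst AE_ball_countable, simp, intro ballI)
    fix u assume u: "u \<in> {t..<T}"
    then have "integrable M (gain (continuation u) s k u)"
      by (intro gain_integrable[OF s] continuation_integrable) auto
    then show "AE \<omega> in M. real_cond_exp M (F t) (gain (continuation u) s k u) \<omega> \<ge> 0"
      by (intro Ft.real_cond_exp_pos gain[OF u]) auto
  qed
  with outcome_decomp[OF s t, of k] show ?thesis
  proof eventually_elim
    case (elim \<omega>)
    have "(\<Sum>u\<in>{t..<T}. real_cond_exp M (F t) (gain (continuation u) s k u) \<omega>) \<ge> 0"
      by (rule sum_nonneg) (use elim in blast)
    then show ?case using elim(1) by simp
  qed
qed

lemma outcome_le:
  assumes s: "s \<in> SAG_profiles M F T t" and t: "t \<le> T"
    and gain: "\<And>u. u \<in> {t..<T} \<Longrightarrow> AE \<omega> in M. gain (continuation u) s k u \<omega> \<le> 0"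
  shows "AE \<omega> in M. SAG_outcome M F X G U t s k \<omega> \<le> U t \<omega> $ k"
proof -
  interpret Ft: sigma_finite_subalgebra M "F t" by (rule sigma_finite_F[OF t])
  have "AE \<omega> in M. \<forall>u\<in>{t..<T}. real_cond_exp M (F t) (gain (continuation u) s k u) \<omega> \<le> 0"
  proof (subst AE_ball_countable, simp, intro ballI)
    fix u assume u: "u \<in> {t..<T}"
    then have "integrable M (gain (continuation u) s k u)"
      by (intro gain_integrable[OF s] continuation_integrable) auto
    then show "AE \<omega> in M. real_cond_exp M (F t) (gain (continuation u) s k u) \<omega> \<le> 0"
      by (intro Ft.real_cond_exp_le_c gain[OF u]) auto
  qed
  with outcome_decomp[OF s t, of k] show ?thesis
  proof eventually_elim
    case (elim \<omega>)
    have "(\<Sum>u\<in>{t..<T}. real_cond_exp M (F t) (gain (continuation u) s k u) \<omega>) \<le> 0"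
      by (rule sum_nonpos) (use elim in blast)
    then show ?case using elim(1) by simp
  qed
qed

section \<open>First contact times and the signs of conditional gains\<close>

abbreviation contact :: "nat \<Rightarrow> 'n \<Rightarrow> 'a \<Rightarrow> nat" where
  "contact \<equiv> first_contact T X U"

lemma contact_props:
  assumes t: "t \<le> T" and \<omega>: "\<omega> \<in> space M"
  shows "contact t i \<omega> \<in> {t..T}" "U (contact t i \<omega>) \<omega> $ i = X (contact t i \<omega>) \<omega> $ i"
    "\<And>u. t \<le> u \<Longrightarrow> u < contact t i \<omega> \<Longrightarrow> U u \<omega> $ i \<noteq> X u \<omega> $ i"
proof -
  let ?K = "{u \<in> {t..T}. U u \<omega> $ i = X u \<omega> $ i}"
  \<comment> \<open>The terminal condition holds at every point of the space, so the infimum is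
    attained on every path.\<close>
  have "T \<in> ?K" using t U_terminal[OF \<omega>] by simp
  then have "?K \<noteq> {}" by blast
  then have K: "contact t i \<omega> \<in> ?K" unfolding first_contact_def by (rule Inf_nat_def1)
  then show "contact t i \<omega> \<in> {t..T}" "U (contact t i \<omega>) \<omega> $ i = X (contact t i \<omega>) \<omega> $ i" by auto
  fix u assume u: "t \<le> u" "u < contact t i \<omega>"
  show "U u \<omega> $ i \<noteq> X u \<omega> $ i"
  proof
    assume "U u \<omega> $ i = X u \<omega> $ i"
    then have "u \<in> ?K" using u K by auto
    then have "contact t i \<omega> \<le> u" unfolding first_contact_def by (intro cInf_lower) auto
    then show False using u by simp
  qed
qed

text \<open>Serves the stopping time property: the right side is a finite union of events known at
  time \<open>v\<close>, and \<open>min T v\<close> covers \<open>v\<close> beyond the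
  horizon.\<close>

lemma contact_le_iff:
  assumes t: "t \<le> T" and \<omega>: "\<omega> \<in> space M"
  shows "contact t i \<omega> \<le> v \<longleftrightarrow> (\<exists>u\<in>{t..min T v}. U u \<omega> $ i = X u \<omega> $ i)"
proof
  assume "contact t i \<omega> \<le> v"
  then show "\<exists>u\<in>{t..min T v}. U u \<omega> $ i = X u \<omega> $ i"
    using contact_props(1,2)[OF assms, of i] by (intro bexI[of _ "contact t i \<omega>"]) auto
next
  assume "\<exists>u\<in>{t..min T v}. U u \<omega> $ i = X u \<omega> $ i"
  then obtain u where "t \<le> u" "u \<le> v" "U u \<omega> $ i = X u \<omega> $ i" by auto
  then show "contact t i \<omega> \<le> v" using contact_props(3)[OF assms, of u i] by force
qed

lemma contact_stopping_time:
  assumes t: "t \<le> T" shows "contact t i \<in> stopping_times M F T t"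
proof -
  have "Measurable.pred (F v) (\<lambda>\<omega>. contact t i \<omega> \<le> v)" for v
  proof -
    have "Measurable.pred (F v) (\<lambda>\<omega>. \<exists>u\<in>{t..min T v}. U u \<omega> $ i = X u \<omega> $ i)"
    proof (rule pred_intros_finite)
      fix u assume u: "u \<in> {t..min T v}"
      then have "U u \<in> borel_measurable (F v)" "X u \<in> borel_measurable (F v)"
        using U_adapted[of u] X_adapted[of u] measurable_from_subalg[OF subalgebra_F[of u v]] by auto
      then show "Measurable.pred (F v) (\<lambda>\<omega>. U u \<omega> $ i = X u \<omega> $ i)" by simp
    qed simp
    then show ?thesis
      by (subst measurable_cong[OF contact_le_iff[OF t]]) (simp_all add: space_F)
  qed
  then show ?thesis
    using contact_props(1)[OF t] by (simp add: stopping_times_def stopping_time_def)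
qed

lemma contact_iff:
  assumes "t \<le> T" "\<omega> \<in> space M" "t \<le> u" "u \<le> contact t i \<omega>"
  shows "contact t i \<omega> = u \<longleftrightarrow> U u \<omega> $ i = X u \<omega> $ i"
  using contact_props(2)[OF assms(1,2), of i] contact_props(3)[OF assms(1,2), of u i] assms(3,4) by (metis le_neq_implies_less)

text \<open>If \<open>k\<close> stops at \<open>u\<close>, the gain is zero by contact. If
  \<open>k\<close> waits, \<open>U u\<close> lies strictly above \<open>X u\<close> at
  \<open>k\<close>, as \<open>SOL_le_passive\<close> requires, whatever set the others form.\<close>

lemma gain_nonneg_of_contact:
  assumes s: "s k = contact t k" and t: "t \<le> T" and u: "u \<in> {t..<T}"
  shows "AE \<omega> in M. gain (continuation u) s k u \<omega> \<ge> 0"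
proof -
  have "AE \<omega> in M. U u \<omega> = SOL (X u \<omega>) (continuation u \<omega>) G" using u by (intro U_SOL) simp
  then show ?thesis
    using AE_space[of M]
  proof eventually_elim
    case (elim \<omega>)
    let ?E = "{i. s i \<omega> = u}"
    have "U u \<omega> $ k \<le> exercise_payoff G ?E (X u \<omega>) (continuation u \<omega>) k" if "u \<le> game_end s \<omega>"
    proof -
      have "u \<le> contact t k \<omega>" using that game_end_le[of s \<omega> k] s by simp
      then have c: "s k \<omega> = u \<longleftrightarrow> U u \<omega> $ k = X u \<omega> $ k"
        using contact_iff[OF t, of \<omega> u k] elim u s by simp
      show ?thesis
      proof (cases "s k \<omega> = u")
        case True
        then show ?thesis using c by (simp add: exercise_payoff_def)
      next
        case False
        then have "X u \<omega> $ k < SOL (X u \<omega>) (continuation u \<omega>) G $ k"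
          using c SOL_ge[OF G, of "X u \<omega>" k "continuation u \<omega>"] elim(1) by simp
        from SOL_le_passive[OF G this, of ?E] show ?thesis
          using False elim(1) by (simp add: exercise_payoff_def)
      qed
    qed
    then show ?case using elim by (simp add: gain_eq)
  qed
qed

text \<open>If \<open>k\<close> stops at \<open>u\<close>, \<open>SOL_ge\<close> suffices. If
  \<open>k\<close> waits, the exercisers are exactly the other players in contact, the set of
  \<open>SOL_ge_passive_contact\<close>.\<close>

lemma gain_nonpos_of_contact:
  assumes s: "\<And>j. j \<noteq> k \<Longrightarrow> s j = contact t j" and t: "t \<le> T" and u: "u \<in> {t..<T}"
  shows "AE \<omega> in M. gain (continuation u) s k u \<omega> \<le> 0"
proof -
  have "AE \<omega> in M. U u \<omega> = SOL (X u \<omega>) (continuation u \<omega>) G" using u by (intro U_SOL) simp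
  then show ?thesis
    using AE_space[of M]
  proof eventually_elim
    case (elim \<omega>)
    let ?E = "{i. s i \<omega> = u}"
    have "exercise_payoff G ?E (X u \<omega>) (continuation u \<omega>) k \<le> U u \<omega> $ k" if "u \<le> game_end s \<omega>"
    proof (cases "s k \<omega> = u")
      case True
      then show ?thesis using SOL_ge[OF G, of "X u \<omega>" k "continuation u \<omega>"] elim(1) by (simp add: exercise_payoff_def)
    next
      case False
      have eq: "s j \<omega> = u \<longleftrightarrow> U u \<omega> $ j = X u \<omega> $ j" if "j \<noteq> k" for j
        using contact_iff[OF t, of \<omega> u j] elim u s[OF that] game_end_le[of s \<omega> j] \<open>u \<le> game_end s \<omega>\<close> by simp
      then have "?E = {j. j \<noteq> k \<and> SOL (X u \<omega>) (continuation u \<omega>) G $ j = X u \<omega> $ j}"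
      proof (intro Collect_cong)
        fix j
        show "s j \<omega> = u \<longleftrightarrow> j \<noteq> k \<and> SOL (X u \<omega>) (continuation u \<omega>) G $ j = X u \<omega> $ j"
          using False eq[of j] elim(1) by (cases "j = k") simp_all
      qed
      from SOL_ge_passive_contact[OF G this] show ?thesis
        using False elim(1) by (simp add: exercise_payoff_def)
    qed
    then show ?case using elim by (simp add: gain_eq)
  qed
qed

section \<open>Saddle point inequalities and backward induction for the values\<close>

lemma SAG_profiles_update:
  "s \<in> SAG_profiles M F T t \<Longrightarrow> a \<in> stopping_times M F T t \<Longrightarrow> s(k := a) \<in> SAG_profiles M F T t"
  by (simp add: SAG_profiles_def)

lemma contact_profile: "t \<le> T \<Longrightarrow> contact t \<in> SAG_profiles M F T t"
  by (simp add: SAG_profiles_def contact_stopping_time)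

text \<open>Induction hypothesis of the backward recursion; it covers exactly the times whose values
  enter the game at \<open>t\<close>.\<close>

definition agrees_after :: "nat \<Rightarrow> (nat \<Rightarrow> 'a \<Rightarrow> real^'n) \<Rightarrow> bool" where
  "agrees_after t V \<longleftrightarrow> (\<forall>u. t < u \<and> u \<le> T \<longrightarrow> V u \<in> borel_measurable M \<and> (AE \<omega> in M. V u \<omega> = U u \<omega>))"

lemma outcome_agrees:
  assumes "agrees_after t V" "t \<le> T" "s \<in> SAG_profiles M F T t"
  shows "AE \<omega> in M. SAG_outcome M F X G V t s k \<omega> = SAG_outcome M F X G U t s k \<omega>"
  using assms by (intro SAG_outcome_cong U_measurable) (auto simp: agrees_after_def)

lemma contact_guarantees:
  assumes V: "agrees_after t V" and t: "t \<le> T" and s: "s \<in> SAG_profiles M F T t"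
  shows "AE \<omega> in M. U t \<omega> $ k \<le> SAG_outcome M F X G V t (s(k := contact t k)) k \<omega>"
proof -
  have p: "s(k := contact t k) \<in> SAG_profiles M F T t"
    by (intro SAG_profiles_update s contact_stopping_time t)
  have "AE \<omega> in M. U t \<omega> $ k \<le> SAG_outcome M F X G U t (s(k := contact t k)) k \<omega>"
    by (intro outcome_ge[OF p t] gain_nonneg_of_contact[OF _ t]) simp_all
  with outcome_agrees[OF V t p, of k] show ?thesis by eventually_elim simp
qed

lemma contact_restrains:
  assumes V: "agrees_after t V" and t: "t \<le> T" and a: "a \<in> stopping_times M F T t"
  shows "AE \<omega> in M. SAG_outcome M F X G V t ((contact t)(k := a)) k \<omega> \<le> U t \<omega> $ k"
proof -
  have p: "(contact t)(k := a) \<in> SAG_profiles M F T t"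
    by (intro SAG_profiles_update contact_profile t a)
  have "AE \<omega> in M. SAG_outcome M F X G U t ((contact t)(k := a)) k \<omega> \<le> U t \<omega> $ k"
    by (intro outcome_le[OF p t] gain_nonpos_of_contact[OF _ t]) simp_all
  with outcome_agrees[OF V t p, of k] show ?thesis by eventually_elim simp
qed

text \<open>Both saddle inequalities are applied to the contact profile itself, where the update at
  \<open>k\<close> changes nothing.\<close>

lemma contact_outcome:
  assumes V: "agrees_after t V" and t: "t \<le> T"
  shows "AE \<omega> in M. U t \<omega> $ k = SAG_outcome M F X G V t (contact t) k \<omega>"
  using contact_guarantees[OF V t contact_profile[OF t], of k]
    contact_restrains[OF V t contact_stopping_time[OF t], of k k]
  unfolding fun_upd_triv by eventually_elim simp

lemma contact_optimal:
  assumes V: "agrees_after t V" and t: "t \<le> T"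
  shows "optimal_equilibrium M F T X G V t (contact t)"
  unfolding optimal_equilibrium_def
proof (intro conjI allI ballI contact_profile t)
  fix k and s :: "'n \<Rightarrow> 'a \<Rightarrow> nat"
  assume "s \<in> SAG_profiles M F T t"
  from contact_guarantees[OF V t this, of k] contact_outcome[OF V t, of k]
  show "AE \<omega> in M. SAG_outcome M F X G V t (contact t) k \<omega> \<le> SAG_outcome M F X G V t (s(k := contact t k)) k \<omega>"
    by eventually_elim simp
next
  fix k a assume "a \<in> stopping_times M F T t"
  from contact_restrains[OF V t this, of k] contact_outcome[OF V t, of k]
  show "AE \<omega> in M. SAG_outcome M F X G V t ((contact t)(k := a)) k \<omega> \<le> SAG_outcome M F X G V t (contact t) k \<omega>"
    by eventually_elim simp
qed

lemma SAG_value_U: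
  assumes V: "agrees_after t V" and t: "t \<le> T"
  shows "SAG_value M F T X G V t (U t)"
proof -
  have meas: "SAG_outcome M F X G V t s k \<in> borel_measurable M" for s k
    by (simp add: SAG_outcome_def)
  have Uk: "(\<lambda>\<omega>. U t \<omega> $ k) \<in> borel_measurable M" for k
    by (intro borel_measurable_vec_nth U_measurable t)
  show ?thesis
    unfolding SAG_value_def
  proof (intro conjI allI U_measurable t)
    fix k
    note saddle = saddle_point_value[where Z = "\<lambda>a s. SAG_outcome M F X G V t (s(k := a)) k"
        and v = "\<lambda>\<omega>. U t \<omega> $ k" and a' = "contact t k" and s' = "contact t"]
    note prems = meas Uk contact_stopping_time[OF t] contact_profile[OF t]
      contact_guarantees[OF V t] contact_restrains[OF V t]
    show "AE \<omega> in M. ereal (U t \<omega> $ k) =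
        family_esssup M (stopping_times M F T t) (\<lambda>a. family_essinf M (SAG_profiles M F T t)
          (\<lambda>s \<omega>'. ereal (SAG_outcome M F X G V t (s(k := a)) k \<omega>'))) \<omega>"
      by (rule saddle(1)) (rule prems | assumption)+
    show "AE \<omega> in M. ereal (U t \<omega> $ k) =
        family_essinf M (SAG_profiles M F T t) (\<lambda>s. family_esssup M (stopping_times M F T t)
          (\<lambda>a \<omega>'. ereal (SAG_outcome M F X G V t (s(k := a)) k \<omega>'))) \<omega>"
      by (rule saddle(2)) (rule prems | assumption)+
  qed
qed

lemma SAG_value_unique:
  assumes V: "agrees_after t V" and t: "t \<le> T" and v: "SAG_value M F T X G V t v"
  shows "AE \<omega> in M. v \<omega> = U t \<omega>"
proof -
  have "AE \<omega> in M. v \<omega> $ k = U t \<omega> $ k" for k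
  proof -
    let ?S = "family_esssup M (stopping_times M F T t) (\<lambda>a. family_essinf M (SAG_profiles M F T t)
       (\<lambda>s \<omega>'. ereal (SAG_outcome M F X G V t (s(k := a)) k \<omega>')))"
    have "AE \<omega> in M. ereal (v \<omega> $ k) = ?S \<omega>" "AE \<omega> in M. ereal (U t \<omega> $ k) = ?S \<omega>"
      using v SAG_value_U[OF V t] by (auto simp: SAG_value_def)
    then show ?thesis by eventually_elim (metis ereal.inject)
  qed
  then have "AE \<omega> in M. \<forall>k. v \<omega> $ k = U t \<omega> $ k" unfolding AE_all_countable by blast
  then show ?thesis by eventually_elim (simp add: vec_eq_iff)
qed

text \<open>Existence of the values: \<open>U\<close> agrees with itself, so the saddle point
  applies at every time.\<close>

lemma value_process_U: "value_process M F T X G U"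
  unfolding value_process_def
  by (intro allI impI SAG_value_U) (simp_all add: agrees_after_def U_measurable)

lemma value_process_eq:
  assumes V: "value_process M F T X G V" and t: "t \<le> T"
  shows "AE \<omega> in M. V t \<omega> = U t \<omega>"
  using t
proof (induction "T - t" arbitrary: t rule: less_induct)
  case less
  have "agrees_after t V"
    unfolding agrees_after_def
  proof (intro allI impI conjI)
    fix u assume u: "t < u \<and> u \<le> T"
    then show "V u \<in> borel_measurable M" using V by (auto simp: value_process_def SAG_value_def)
    show "AE \<omega> in M. V u \<omega> = U u \<omega>" using u by (intro less.hyps) auto
  qed
  then show ?case
    using V less.prems by (intro SAG_value_unique) (auto simp: value_process_def)
qed

lemma value_process_agrees_after:
  assumes "value_process M F T X G V" shows "agrees_after t V"
  using assms value_process_eq[OF assms] by (auto simp: agrees_after_def value_process_def SAG_value_def)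

end

text \<open>Both recursions fix their processes only up to null sets, so existence is asserted first
  and the conclusions are drawn for every pair of versions.\<close>

theorem theorem4p1:
  fixes M :: "'a measure" and F :: "nat \<Rightarrow> 'a measure" and T :: nat
    and X :: "nat \<Rightarrow> 'a \<Rightarrow> real^'n::finite" and G :: "real^'n^'n"
  assumes "prob_space M"
    and "filtration (space M) F"
    and "\<And>t. t \<le> T \<Longrightarrow> subalgebra M (F t)"
    and "\<And>t. t \<le> T \<Longrightarrow> X t \<in> borel_measurable (F t)"
    and "\<And>t. t \<le> T \<Longrightarrow> integrable M (X t)"
    and "K_dagger G"
  shows "(\<exists>U. SOL_process M F T X G U) \<and> (\<exists>V. value_process M F T X G V) \<and>
    (\<forall>U V. SOL_process M F T X G U \<and> value_process M F T X G V \<longrightarrow>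
      (\<forall>t\<le>T. \<forall>k. AE \<omega> in M. U t \<omega> $ k = SAG_outcome M F X G V t (first_contact T X U t) k \<omega>) \<and>
      (\<forall>t\<le>T. optimal_equilibrium M F T X G V t (first_contact T X U t) \<and>
        (AE \<omega> in M. U t \<omega> = V t \<omega>)))"
proof -
  interpret stochastic_affine_game M F T X G
    using assms by (auto simp: stochastic_affine_game_def stochastic_affine_game_axioms_def)
  have solved: "solved_affine_game M F T X G U" if "SOL_process M F T X G U" for U
    using that stochastic_affine_game_axioms
    by (simp add: solved_affine_game_def solved_affine_game_axioms_def)
  show ?thesis
  proof (intro conjI allI impI)
    show "\<exists>U. SOL_process M F T X G U" by (rule SOL_process_exists)
    then show "\<exists>V. value_process M F T X G V"
      using solved solved_affine_game.value_process_U by blast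
  next
    fix U V assume UV: "SOL_process M F T X G U \<and> value_process M F T X G V"
    then interpret solved_affine_game M F T X G U using solved by blast
    have V: "value_process M F T X G V" using UV by blast
    note agrees = value_process_agrees_after[OF V]
    fix t assume t: "t \<le> T"
    show "AE \<omega> in M. U t \<omega> $ k = SAG_outcome M F X G V t (first_contact T X U t) k \<omega>" for k
      by (rule contact_outcome[OF agrees t])
    show "optimal_equilibrium M F T X G V t (first_contact T X U t)"
      by (rule contact_optimal[OF agrees t])
    show "AE \<omega> in M. U t \<omega> = V t \<omega>"
      using value_process_eq[OF V t] by eventually_elim simp
  qed
qed

end
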